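(* Every Halin graph has layered pathwidth at most $2$.
   Context: Graphs are finite, simple and undirected. A Halin graph is a graph formed from a tree with no degree-$2$ vertices (and at least four vertices), embedded in the plane, by connecting the leaves of the tree by a cycle in the order given by the embedding. A path decomposition of a graph is a sequence of vertex subsets (bags) such that each vertex belongs to a nonempty contiguous subsequence of bags and every two adjacent vertices have at least one bag in common. A layering of a graph is a partition of its vertices into a sequence of disjoint subsets (layers) such that each edge joins vertices in the same layer or in consecutive layers. The layered pathwidth of a graph $G$ is the minimum integer $k$ such that for some path decomposition and some layering of $G$, the intersection of each bag with each layer has at most $k$ vertices. *)

theory Defs
  imports "HOL-Analysis.Analysis"
begin

text \<open>A graph is given by its vertex set \<open>V\<close> and its set \<open>E\<close> of two-element edges.\<close>

definition simple_graph :: "'a set \<Rightarrow> 'a set set \<Rightarrow> bool" where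
  "simple_graph V E \<longleftrightarrow> finite V \<and> (\<forall>e\<in>E. e \<subseteq> V \<and> card e = 2)"

definition vdegree :: "'a set set \<Rightarrow> 'a \<Rightarrow> nat" where
  "vdegree E v = card {e \<in> E. v \<in> e}"

definition connected_graph :: "'a set \<Rightarrow> 'a set set \<Rightarrow> bool" where
  "connected_graph V E \<longleftrightarrow>
     V \<noteq> {} \<and> (\<forall>u\<in>V. \<forall>v\<in>V. (u, v) \<in> {(x, y). {x, y} \<in> E}\<^sup>*)"

text \<open>Edges joining cyclically consecutive entries of a list.\<close>

definition cycle_edges :: "'a list \<Rightarrow> 'a set set" where
  "cycle_edges vs = {{vs ! i, vs ! (Suc i mod length vs)} | i. i < length vs}"

definition acyclic_graph :: "'a set set \<Rightarrow> bool" where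
  "acyclic_graph E \<longleftrightarrow> (\<nexists>vs. 3 \<le> length vs \<and> distinct vs \<and> cycle_edges vs \<subseteq> E)"

definition tree_graph :: "'a set \<Rightarrow> 'a set set \<Rightarrow> bool" where
  "tree_graph V E \<longleftrightarrow> simple_graph V E \<and> connected_graph V E \<and> acyclic_graph E"

definition leaves :: "'a set \<Rightarrow> 'a set set \<Rightarrow> 'a set" where
  "leaves V E = {v \<in> V. vdegree E v = 1}"


subsection \<open>Plane embeddings and Halin graphs\<close>

text \<open>
  Vertices are drawn as distinct points of the plane and edges as arcs between their
  endpoints. An arc contains no other vertex, and two arcs meet only at common endpoints.
\<close>

definition plane_embedding ::
  "'a set \<Rightarrow> 'a set set \<Rightarrow> ('a \<Rightarrow> complex) \<Rightarrow> ('a set \<Rightarrow> real \<Rightarrow> complex) \<Rightarrow> bool" where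
  "plane_embedding V E pos crv \<longleftrightarrow>
     inj_on pos V \<and>
     (\<forall>e\<in>E. arc (crv e) \<and> {pathstart (crv e), pathfinish (crv e)} = pos ` e \<and>
             path_image (crv e) \<inter> pos ` V = pos ` e) \<and>
     (\<forall>e\<in>E. \<forall>f\<in>E. e \<noteq> f \<longrightarrow>
             path_image (crv e) \<inter> path_image (crv f) = pos ` (e \<inter> f))"

definition drawing ::
  "'a set \<Rightarrow> 'a set set \<Rightarrow> ('a \<Rightarrow> complex) \<Rightarrow> ('a set \<Rightarrow> real \<Rightarrow> complex) \<Rightarrow> complex set" where
  "drawing V E pos crv = pos ` V \<union> (\<Union>e\<in>E. path_image (crv e))"

text \<open>
  \<open>ls\<close> lists the leaves in the cyclic order given by an embedding of a tree: a closed
  Jordan curve drawn around the tree and touching it exactly at the leaves meets them in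
  this order. Every plane tree with at least two leaves has such a curve, and the order is
  determined by the embedding up to the starting leaf and the direction of traversal.
\<close>

definition leaf_order ::
  "'a set \<Rightarrow> 'a set set \<Rightarrow> ('a \<Rightarrow> complex) \<Rightarrow> ('a set \<Rightarrow> real \<Rightarrow> complex) \<Rightarrow> 'a list \<Rightarrow> bool" where
  "leaf_order V E pos crv ls \<longleftrightarrow>
     distinct ls \<and> set ls = leaves V E \<and>
     (\<exists>g t. simple_path g \<and> pathfinish g = pathstart g \<and>
        drawing V E pos crv - pos ` leaves V E \<subseteq> inside (path_image g) \<and>
        (\<forall>i<length ls. 0 \<le> t i \<and> t i < (1::real) \<and> g (t i) = pos (ls ! i)) \<and>
        (\<forall>i j. i < j \<and> j < length ls \<longrightarrow> t i < t j))"

definition halin_graph :: "'a set \<Rightarrow> 'a set set \<Rightarrow> bool" where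
  "halin_graph V E \<longleftrightarrow>
     (\<exists>T pos crv ls.
        tree_graph V T \<and> 4 \<le> card V \<and> (\<forall>v\<in>V. vdegree T v \<noteq> 2) \<and>
        plane_embedding V T pos crv \<and> leaf_order V T pos crv ls \<and>
        E = T \<union> cycle_edges ls)"


subsection \<open>Layered pathwidth\<close>

definition path_decomposition :: "'a set \<Rightarrow> 'a set set \<Rightarrow> 'a set list \<Rightarrow> bool" where
  "path_decomposition V E Bs \<longleftrightarrow>
     (\<forall>B\<in>set Bs. B \<subseteq> V) \<and>
     (\<forall>v\<in>V. \<exists>i j. i \<le> j \<and> {k. k < length Bs \<and> v \<in> Bs ! k} = {i..j}) \<and>
     (\<forall>e\<in>E. \<exists>B\<in>set Bs. e \<subseteq> B)"

definition layering :: "'a set \<Rightarrow> 'a set set \<Rightarrow> 'a set list \<Rightarrow> bool" where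
  "layering V E Ls \<longleftrightarrow>
     \<Union> (set Ls) = V \<and>
     (\<forall>i<length Ls. \<forall>j<length Ls. i \<noteq> j \<longrightarrow> Ls ! i \<inter> Ls ! j = {}) \<and>
     (\<forall>i<length Ls. \<forall>j<length Ls. \<forall>u\<in>Ls ! i. \<forall>v\<in>Ls ! j.
        {u, v} \<in> E \<longrightarrow> i \<le> Suc j \<and> j \<le> Suc i)"

definition layered_pathwidth :: "'a set \<Rightarrow> 'a set set \<Rightarrow> nat" where
  "layered_pathwidth V E =
     (LEAST k. \<exists>Bs Ls. path_decomposition V E Bs \<and> layering V E Ls \<and>
        (\<forall>B\<in>set Bs. \<forall>L\<in>set Ls. card (B \<inter> L) \<le> k))"

text \<open>The minimum is attained: one bag and one layer give some finite width.\<close>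

lemma layered_pathwidth_attained:
  assumes "simple_graph V E"
  shows "\<exists>Bs Ls. path_decomposition V E Bs \<and> layering V E Ls \<and>
           (\<forall>B\<in>set Bs. \<forall>L\<in>set Ls. card (B \<inter> L) \<le> layered_pathwidth V E)"
proof -
  have "\<exists>i j. i \<le> j \<and> {k. k < length [V] \<and> v \<in> [V] ! k} = {i..j}" if "v \<in> V" for v
    using that by (intro exI[of _ 0]) auto
  then have "path_decomposition V E [V]"
    using assms unfolding path_decomposition_def simple_graph_def by simp
  moreover have "layering V E [V]"
    by (auto simp: layering_def)
  ultimately have "\<exists>k Bs Ls. path_decomposition V E Bs \<and> layering V E Ls \<and>
      (\<forall>B\<in>set Bs. \<forall>L\<in>set Ls. card (B \<inter> L) \<le> k)"
    by (intro exI[of _ "card V"] exI[of _ "[V]"]) simp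
  then show ?thesis
    unfolding layered_pathwidth_def by (rule LeastI_ex)
qed

end

theory Submission
  imports Defs
begin

text \<open>
  Root the tree at the first leaf \<open>r\<close> in the cyclic order. Planarity enters once: the leaves
  below a vertex \<open>v \<noteq> r\<close> form an interval of the leaf order. Otherwise some leaf outside lies
  between two leaves below \<open>v\<close>. The descendants of \<open>v\<close> and the remaining vertices span disjoint
  connected subgraphs, and each of them would contain two of four interleaved points of the
  Jordan curve through the leaves, which \<open>loop_chords_meet\<close> forbids. Without vertices of degree 2,
  a vertex is determined by its interval. So the rooted tree is a laminar family of intervals
  in which edges are covering pairs and whose root is the neighbour of \<open>r\<close>. The rest of the argument
  concerns such families only.

  The layers come from peeling off spines. The spine of a vertex \<open>s\<close> is the tree path from the
  first leaf below \<open>s\<close> through \<open>s\<close> to the last leaf below \<open>s\<close>. The spine of the root of the family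
  has rank 0; deleting it leaves subtrees, whose roots have spines of rank 1, and so on. Both ends
  of every spine are leaves, and this keeps the ranks of consecutive leaves within distance 1
  (\<open>consecutive_leaf_levels\<close>).

  The bags come from sweeping over the gaps between consecutive leaves. Call the lowest vertex of a
  spine whose interval contains a given leaf the owner of this leaf on that spine. A rank has at
  most one owner for every leaf (\<open>owner_unique\<close>), and the bag of a gap collects the owners of the
  two leaves next to it, hence at most two vertices of every rank. The root \<open>r\<close> forms a layer above
  rank 0 and joins all bags. This serves the tree edge at \<open>r\<close> and the two cycle edges at \<open>r\<close>,
  whose other ends have rank 0.

  One kind of vertex owns no leaf: the middle \<open>s\<close> of a spine, if it has exactly two children.
  At the gap that separates these children, \<open>s\<close> would be a third vertex of its rank. It is
  therefore moved to the layer of its parent, which owns both leaves next to this gap and is the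
  only other vertex of this layer in the bag (\<open>card_bag_level_le_2\<close>). The root of the family moves
  to the layer of \<open>r\<close> in this case.
\<close>

section \<open>Chords of a Jordan curve\<close>

lemma simple_path_eq_iff_half_open:
  assumes "simple_path g" "0 \<le> s" "s < 1" "0 \<le> t" "t < (1::real)"
  shows "g s = g t \<longleftrightarrow> s = t"
  using assms unfolding simple_path_def loop_free_def by force

lemma arc_avoids_ends:
  assumes "arc c" "0 < w" "w < (1::real)"
  shows "c w \<noteq> pathstart c" "c w \<noteq> pathfinish c"
  using assms inj_onD[of c "{0..1}" w 0] inj_onD[of c "{0..1}" w 1]
  by (auto simp: arc_def pathstart_def pathfinish_def)

text \<open>
  A chord in \<open>P\<close> splits the inside of the curve into two regions, each bounded by the chord and
  one of the two arcs into which its ends divide the curve. A path in \<open>Q\<close> that misses the chord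
  stays in one region, so both its ends lie on the arc bounding that region. But the ends
  of the chord separate \<open>g s\<close> from \<open>g u\<close> on the curve.
\<close>

lemma loop_chords_meet_at_start:
  fixes g :: "real \<Rightarrow> complex"
  assumes g: "simple_path g" "pathfinish g = pathstart g"
    and s: "0 < s" "s < t" "t < u" "u < 1"
    and P: "path_component P (g 0) (g t)" "P \<inter> path_image g \<subseteq> {g 0, g t}"
      "P \<subseteq> inside (path_image g) \<union> path_image g"
    and Q: "path_component Q (g s) (g u)" "Q \<inter> path_image g \<subseteq> {g s, g u}"
      "Q \<subseteq> inside (path_image g) \<union> path_image g"
  shows "P \<inter> Q \<noteq> {}"
proof
  assume disj: "P \<inter> Q = {}"
  have inj: "g x = g y \<longleftrightarrow> x = y" if "0 \<le> x" "x < 1" "0 \<le> y" "y < 1" for x y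
    using simple_path_eq_iff_half_open[OF g(1) that] .
  have g1: "g 1 = g 0"
    using g(2) by (simp add: pathstart_def pathfinish_def)
  define c1 where "c1 = subpath 0 t g"
  define c2 where "c2 = reversepath (subpath t 1 g)"
  have im1: "path_image c1 = g ` {0..t}" and im2: "path_image c2 = g ` {t..1}"
    using s by (auto simp: c1_def c2_def path_image_subpath)
  have "{0..t} \<union> {t..1} = {0..1}" using s by auto
  then have un: "path_image c1 \<union> path_image c2 = path_image g"
    unfolding im1 im2 by (simp add: path_image_def flip: image_Un)
  \<comment> \<open>The closing point \<open>g 1 = g 0\<close> is split off because \<open>g\<close> is injective on \<open>{0..<1}\<close> only.\<close>
  have im2': "g ` {t..1} = insert (g 0) (g ` {t..<1})"
  proof -
    have "{t..1} = insert 1 {t..<1}" using s by auto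
    then show ?thesis using g1 by auto
  qed
  have c12: "path_image c1 \<inter> path_image c2 = {g 0, g t}"
    unfolding im1 im2 im2' using s by (auto simp: inj)
  have ne: "g 0 \<noteq> g t" using s by (simp add: inj)
  obtain p where p: "path p" "path_image p \<subseteq> P" "pathstart p = g 0" "pathfinish p = g t"
    using P(1) unfolding path_component_def by blast
  obtain c where c: "arc c" "path_image c \<subseteq> path_image p" "pathstart c = g 0" "pathfinish c = g t"
    using path_contains_arc[OF p(1,3,4) ne] by blast
  have cP: "path_image c \<subseteq> P" using c p by auto
  have cends: "g 0 \<in> path_image c" "g t \<in> path_image c"
    using c by (metis pathstart_in_path_image, metis c(4) pathfinish_in_path_image)
  have cg: "path_image c \<inter> path_image g = {g 0, g t}"
  proof -
    have "g 0 \<in> path_image g" "g t \<in> path_image g"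
      using s by (auto simp: path_image_def)
    then show ?thesis using cP P(2) cends by auto
  qed
  have "c (1/2) \<in> path_image c" by (auto simp: path_image_def)
  moreover have "c (1/2) \<noteq> g 0" "c (1/2) \<noteq> g t"
    using arc_avoids_ends[OF c(1), of "1/2"] c(3,4) by auto
  ultimately have mid: "path_image c \<inter> inside (path_image g) \<noteq> {}"
    using cP P(3) cg by blast
  have sp1: "simple_path c1" unfolding c1_def
    using g(1) s by (intro simple_path_subpath) auto
  have sp2: "simple_path c2" unfolding c2_def
    using g(1) s by (intro simple_path_reversepath simple_path_subpath) auto
  have ends: "pathstart c1 = g 0" "pathfinish c1 = g t" "pathstart c2 = g 0" "pathfinish c2 = g t"
    by (auto simp: c1_def c2_def g1)
  define U1 U2 where "U1 = inside (path_image c1 \<union> path_image c)"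
    and "U2 = inside (path_image c2 \<union> path_image c)"
  have c1c: "path_image c1 \<inter> path_image c = {g 0, g t}"
    and c2c: "path_image c2 \<inter> path_image c = {g 0, g t}"
    using c12 cg un cends by blast+
  have U: "U1 \<inter> U2 = {}" "U1 \<union> U2 \<union> (path_image c - {g 0, g t}) = inside (path_image g)"
    using split_inside_simple_closed_curve[OF sp1 ends(1,2) sp2 ends(3,4)
        arc_imp_simple_path[OF c(1)] c(3,4) ne c12 c1c c2c] mid
    unfolding U1_def U2_def un by metis+
  have clo: "closed (path_image c1 \<union> path_image c)" "closed (path_image c2 \<union> path_image c)"
    using sp1 sp2 c(1)
    by (simp_all add: closed_Un closed_path_image simple_path_imp_path arc_imp_path)
  have opn: "open U1" "open U2"
    using clo by (auto simp: U1_def U2_def intro: open_inside)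
  have clU: "closure U1 \<subseteq> path_image c1 \<union> path_image c \<union> U1"
    "closure U2 \<subseteq> path_image c2 \<union> path_image c \<union> U2"
    using closure_inside_subset[OF clo(1)] closure_inside_subset[OF clo(2)]
    by (auto simp: U1_def U2_def)
  have neQ: "g s \<noteq> g u" using s by (simp add: inj)
  obtain q0 where q0: "path q0" "path_image q0 \<subseteq> Q" "pathstart q0 = g s" "pathfinish q0 = g u"
    using Q(1) unfolding path_component_def by blast
  obtain q where q: "arc q" "path_image q \<subseteq> path_image q0" "pathstart q = g s" "pathfinish q = g u"
    using path_contains_arc[OF q0(1,3,4) neQ] by blast
  have qQ: "path_image q \<subseteq> Q" using q q0 by auto
  \<comment> \<open>\<open>J\<close> is connected and avoids the chord, so it lies in one region, with \<open>g s\<close> and \<open>g u\<close> in its closure.\<close>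
  define J where "J = q ` {0<..<1}"
  have qc: "continuous_on {0..1} q" using q(1) by (simp add: arc_def path_def)
  have "connected J" unfolding J_def
    by (intro connected_continuous_image continuous_on_subset[OF qc]) auto
  have Jsub: "J \<subseteq> U1 \<union> U2"
  proof
    fix z assume "z \<in> J"
    then obtain w where w: "0 < w" "w < 1" "z = q w" by (auto simp: J_def)
    have "z \<noteq> g s" "z \<noteq> g u"
      using arc_avoids_ends[OF q(1) w(1,2)] q(3,4) w(3) by auto
    moreover have "z \<in> Q" using qQ w by (auto simp: path_image_def)
    ultimately have "z \<in> inside (path_image g)" using Q(2,3) by blast
    moreover have "z \<notin> path_image c" using \<open>z \<in> Q\<close> disj cP by auto
    ultimately show "z \<in> U1 \<union> U2" using U(2) by blast
  qed
  have cl: "{g s, g u} \<subseteq> closure J"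
  proof -
    have "q ` closure {0<..<1} \<subseteq> closure J"
      by (rule image_closure_subset) (auto simp: J_def qc intro: closure_subset[THEN subsetD])
    then have "q w \<in> closure J" if "w \<in> {0..1}" for w
      using that by (simp add: image_subset_iff)
    from this[of 0] this[of 1] show ?thesis
      using q(3,4) by (simp add: pathstart_def pathfinish_def)
  qed
  have ong: "g s \<in> path_image g" "g u \<in> path_image g"
    using s by (auto simp: path_image_def)
  have "g s \<noteq> g 0" "g s \<noteq> g t" "g u \<noteq> g 0" "g u \<noteq> g t"
    using s by (simp_all add: inj)
  then have notc: "g s \<notin> path_image c" "g u \<notin> path_image c"
    using cg ong by blast+
  have notins: "g s \<notin> inside (path_image g)" "g u \<notin> inside (path_image g)"
    using inside_no_overlap[of "path_image g"] ong by blast+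
  have "J \<subseteq> U1 \<or> J \<subseteq> U2"
    using connectedD[OF \<open>connected J\<close> opn] U(1) Jsub by blast
  then show False
  proof
    assume "J \<subseteq> U1"
    then have "g u \<in> path_image c1 \<union> path_image c \<union> U1" using cl closure_mono clU(1) by blast
    then have "g u \<in> path_image c1" using notc notins U(2) by blast
    then show False unfolding im1 using s by (auto simp: inj)
  next
    assume "J \<subseteq> U2"
    then have "g s \<in> path_image c2 \<union> path_image c \<union> U2" using cl closure_mono clU(2) by blast
    then have "g s \<in> path_image c2" using notc notins U(2) by blast
    then show False unfolding im2 im2' using s by (auto simp: inj)
  qed
qed

lemma loop_chords_meet:
  fixes g :: "real \<Rightarrow> complex"
  assumes g: "simple_path g" "pathfinish g = pathstart g"
    and t: "0 \<le> t1" "t1 < t2" "t2 < t3" "t3 < t4" "t4 < 1"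
    and P: "path_component P (g t1) (g t3)" "P \<inter> path_image g \<subseteq> {g t1, g t3}"
      "P \<subseteq> inside (path_image g) \<union> path_image g"
    and Q: "path_component Q (g t2) (g t4)" "Q \<inter> path_image g \<subseteq> {g t2, g t4}"
      "Q \<subseteq> inside (path_image g) \<union> path_image g"
  shows "P \<inter> Q \<noteq> {}"
proof -
  \<comment> \<open>Starting the loop at \<open>t1\<close> instead of 0 reduces to the previous case.\<close>
  define h where "h = shiftpath t1 g"
  have h: "simple_path h" "pathfinish h = pathstart h" "path_image h = path_image g"
    using g t by (auto simp: h_def simple_path_shiftpath path_image_shiftpath closed_shiftpath)
  have ht: "h (t - t1) = g t" if "t < 1" for t
    using that by (simp add: h_def shiftpath_def)
  have h0: "h 0 = g t1" using ht[of t1] t by simp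
  show ?thesis
    by (rule loop_chords_meet_at_start[of h "t2 - t1" "t3 - t1" "t4 - t1"])
       (use h h0 t P Q in \<open>simp_all add: ht\<close>)
qed

section \<open>Laminar families of intervals\<close>

text \<open>
  The role of a vertex on the spine that contains it: \<open>Top\<close> is the vertex where a spine starts,
  \<open>Left\<close> and \<open>Right\<close> are the vertices on its two branches, which descend to the first and
  to the last leaf below that vertex.
\<close>

datatype position = Top | Left | Right

text \<open>
  A rooted tree without vertices that have exactly one child, given by the intervals
  \<open>{a v..<b v}\<close> of the leaves below its vertices: descendants have smaller intervals,
  unrelated vertices have disjoint ones.
\<close>

locale interval_tree =
  fixes W :: "'a set" and a b :: "'a \<Rightarrow> nat" and m :: nat and root :: 'a and leaf :: "nat \<Rightarrow> 'a"
  assumes nonempty: "v \<in> W \<Longrightarrow> a v < b v"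
    and inj: "v \<in> W \<Longrightarrow> w \<in> W \<Longrightarrow> a v = a w \<Longrightarrow> b v = b w \<Longrightarrow> v = w"
    and laminar: "v \<in> W \<Longrightarrow> w \<in> W \<Longrightarrow>
      b v \<le> a w \<or> b w \<le> a v \<or> (a v \<le> a w \<and> b w \<le> b v) \<or> (a w \<le> a v \<and> b v \<le> b w)"
    and bounded: "v \<in> W \<Longrightarrow> b v \<le> m"
    and root: "root \<in> W" "a root = 0" "b root = m"
    and leaf: "i < m \<Longrightarrow> leaf i \<in> W" "i < m \<Longrightarrow> a (leaf i) = i" "i < m \<Longrightarrow> b (leaf i) = Suc i"
begin

definition below :: "'a \<Rightarrow> 'a \<Rightarrow> bool" where
  "below w v \<longleftrightarrow> w \<in> W \<and> v \<in> W \<and> w \<noteq> v \<and> a v \<le> a w \<and> b w \<le> b v"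

definition child :: "'a \<Rightarrow> 'a \<Rightarrow> bool" where
  "child w v \<longleftrightarrow> below w v \<and> (\<nexists>u. below w u \<and> below u v)"

definition width :: "'a \<Rightarrow> nat" where
  "width v = b v - a v"

lemma below_width:
  assumes "below w v"
  shows "width w < width v"
proof -
  have "a v \<noteq> a w \<or> b w \<noteq> b v" using inj[of w v] assms by (auto simp: below_def)
  then show ?thesis using nonempty[of w] assms by (auto simp: below_def width_def)
qed

lemma child_below: "child w v \<Longrightarrow> below w v"
  by (simp add: child_def)

lemma below_root: "v \<in> W \<Longrightarrow> v \<noteq> root \<Longrightarrow> below v root"
  by (simp add: below_def root bounded)

lemma not_below_root: "\<not> below root v"
proof
  assume "below root v"
  then have v: "v \<in> W" "v \<noteq> root" "a v = 0" "m \<le> b v" by (auto simp: below_def root)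
  have "b v = b root" using bounded[OF v(1)] v(4) root(3) by simp
  then show False using inj[OF v(1) root(1)] v(2,3) root(2) by simp
qed

lemma overlap_nested:
  assumes "v \<in> W" "w \<in> W" "v \<noteq> w" "a v \<le> t" "t < b v" "a w \<le> t" "t < b w"
  shows "below v w \<or> below w v"
proof -
  have "\<not> b v \<le> a w" "\<not> b w \<le> a v" using assms by linarith+
  then show ?thesis using laminar[OF assms(1,2)] assms(1-3) unfolding below_def by blast
qed

text \<open>
  Among the intervals around a given one, the shortest is its parent.
\<close>

lemma parent_exists:
  assumes "v \<in> W" "v \<noteq> root"
  shows "\<exists>p. child v p"
proof -
  define p where "p = (ARG_MIN width u. below v u)"
  have p: "below v p" and min: "width p \<le> width u" if "below v u" for u
    using arg_min_nat_lemma[of "below v" root width] below_root[OF assms] that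
    by (auto simp: p_def)
  have "\<not> below u p" if "below v u" for u
    using min[OF that] below_width[of u p] by auto
  with p[OF below_root[OF assms]] show ?thesis by (auto simp: child_def)
qed

lemma parent_unique:
  assumes "child v p" "child v q"
  shows "p = q"
proof (rule ccontr)
  assume "p \<noteq> q"
  then have "below p q \<or> below q p"
    using assms nonempty[of v] by (intro overlap_nested[of p q "a v"]) (auto simp: child_def below_def)
  with assms show False by (auto simp: child_def)
qed

definition parent :: "'a \<Rightarrow> 'a" where
  "parent v = (SOME p. child v p)"

lemma child_parent: "v \<in> W \<Longrightarrow> v \<noteq> root \<Longrightarrow> child v (parent v)"
  unfolding parent_def by (rule someI_ex) (rule parent_exists)

lemma parent_eq: "child v p \<Longrightarrow> parent v = p"
  unfolding parent_def using parent_unique by blast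

lemma child_towards_exists:
  assumes v: "v \<in> W" "Suc (a v) < b v" and t: "a v \<le> t" "t < b v"
  shows "\<exists>w. child w v \<and> a w \<le> t \<and> t < b w"
proof -
  let ?P = "\<lambda>w. below w v \<and> a w \<le> t \<and> t < b w"
  have tm: "t < m" using t(2) bounded[OF v(1)] by simp
  have "?P (leaf t)"
    using leaf[OF tm] v t by (auto simp: below_def)
  moreover have "\<forall>w. ?P w \<longrightarrow> width w < width v"
    using below_width by auto
  ultimately have "\<exists>w. ?P w \<and> (\<forall>u. ?P u \<longrightarrow> width u \<le> width w)"
    by (rule ex_has_greatest_nat[where P = ?P])
  then obtain w where w: "?P w" and max: "\<And>u. ?P u \<Longrightarrow> width u \<le> width w"
    by blast
  have False if "below w u" "below u v" for u
    using max[of u] below_width[OF that(1)] that w by (auto simp: below_def)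
  with w show ?thesis by (auto simp: child_def)
qed

lemma child_towards_unique:
  assumes "child w v" "child u v" "a w \<le> t" "t < b w" "a u \<le> t" "t < b u"
  shows "w = u"
proof (rule ccontr)
  assume "w \<noteq> u"
  then have "below w u \<or> below u w"
    using assms by (intro overlap_nested[of w u t]) (auto simp: child_def below_def)
  with assms show False by (auto simp: child_def)
qed

definition child_towards :: "'a \<Rightarrow> nat \<Rightarrow> 'a" where
  "child_towards v t = (SOME w. child w v \<and> a w \<le> t \<and> t < b w)"

lemma child_towards:
  assumes "v \<in> W" "Suc (a v) < b v" "a v \<le> t" "t < b v"
  shows "child (child_towards v t) v" "a (child_towards v t) \<le> t" "t < b (child_towards v t)"
proof -
  have "child (child_towards v t) v \<and> a (child_towards v t) \<le> t \<and> t < b (child_towards v t)"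
    unfolding child_towards_def by (rule someI_ex[OF child_towards_exists[OF assms]])
  then show "child (child_towards v t) v" "a (child_towards v t) \<le> t" "t < b (child_towards v t)"
    by blast+
qed

lemma child_towards_eq:
  assumes "child w v" "a w \<le> t" "t < b w"
  shows "child_towards v t = w"
proof -
  have "child (child_towards v t) v \<and> a (child_towards v t) \<le> t \<and> t < b (child_towards v t)"
    unfolding child_towards_def using assms
    by (intro someI[of "\<lambda>w. child w v \<and> a w \<le> t \<and> t < b w" w] conjI)
  then show ?thesis using child_towards_unique assms by blast
qed

lemma childD:
  assumes "child w v"
  shows "w \<in> W" "v \<in> W" "a v \<le> a w" "b w \<le> b v" "a w < b w" "Suc (a v) < b v"
    "a w = a v \<Longrightarrow> b w \<noteq> b v" "width w < width v"
proof -
  have w: "w \<in> W" "v \<in> W" "w \<noteq> v" "a v \<le> a w" "b w \<le> b v"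
    using child_below[OF assms] by (auto simp: below_def)
  have "a w < b w" using nonempty[OF w(1)] .
  moreover have "width w < width v" using below_width[OF child_below[OF assms]] .
  moreover have "Suc (a v) < b v"
    using w(4,5) \<open>a w < b w\<close> \<open>width w < width v\<close> unfolding width_def by linarith
  moreover have "b w \<noteq> b v" if "a w = a v"
    using inj[OF w(1,2) that] w(3) by blast
  ultimately show "w \<in> W" "v \<in> W" "a v \<le> a w" "b w \<le> b v" "a w < b w" "Suc (a v) < b v"
    "a w = a v \<Longrightarrow> b w \<noteq> b v" "width w < width v"
    using w by blast+
qed

lemma children_disjoint:
  assumes "child w v" "child u v" "w \<noteq> u"
  shows "b w \<le> a u \<or> b u \<le> a w"
proof (rule ccontr)
  assume "\<not> ?thesis"
  then have "child_towards v (max (a w) (a u)) = w" "child_towards v (max (a w) (a u)) = u"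
    using childD(5)[OF assms(1)] childD(5)[OF assms(2)]
    by (auto intro!: child_towards_eq assms(1,2))
  with assms(3) show False by simp
qed

text \<open>
  Recursion from the root downwards: the value at a child is obtained by \<open>h\<close> from the value at
  its parent.
\<close>

definition descend :: "'b \<Rightarrow> ('a \<Rightarrow> 'b \<Rightarrow> 'b) \<Rightarrow> 'a \<Rightarrow> 'b" where
  "descend z h = wfrec {(p, v). child v p} (\<lambda>f v. if \<exists>p. child v p then h v (f (parent v)) else z)"

lemma wf_child: "wf {(p, v). child v p}"
proof (rule wf_subset[OF wf_measure[of "\<lambda>v. m - width v"]], clarify)
  fix p v assume c: "child v p"
  have "width v < width p" "width p \<le> m"
    using childD(8)[OF c] bounded[OF childD(2)[OF c]] unfolding width_def by linarith+
  then show "(p, v) \<in> Wellfounded.measure (\<lambda>v. m - width v)" by simp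
qed

lemma descend_root: "descend z h root = z"
  unfolding descend_def by (subst wfrec[OF wf_child]) (use not_below_root child_below in auto)

lemma descend_child:
  assumes "child w v"
  shows "descend z h w = h w (descend z h v)"
proof -
  have "descend z h w = h w (cut (descend z h) {(p, v). child v p} w (parent w))"
    using assms unfolding descend_def by (subst wfrec[OF wf_child]) auto
  then show ?thesis using assms by (simp add: cut_apply parent_eq)
qed

text \<open>
  The branch of a spine continues to a child with the same end. From a \<open>Top\<close> vertex both branches
  leave; a vertex on the left branch continues only to the child with the same first leaf, and
  its child with the same last leaf starts a spine of its own.
\<close>

definition position :: "'a \<Rightarrow> position" where
  "position = descend Top (\<lambda>w pos.
     if a w = a (parent w) \<and> pos \<noteq> Right then Left
     else if b w = b (parent w) \<and> pos \<noteq> Left then Right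
     else Top)"

text \<open>
  The number of times that the path from the root changes to a new spine.
\<close>

definition rank :: "'a \<Rightarrow> nat" where
  "rank = descend 0 (\<lambda>w n. if position w = Top then Suc n else n)"

lemma position_root: "position root = Top" and rank_root: "rank root = 0"
  by (simp_all add: position_def rank_def descend_root)

lemma position_child:
  "child w v \<Longrightarrow> position w =
     (if a w = a v \<and> position v \<noteq> Right then Left
      else if b w = b v \<and> position v \<noteq> Left then Right
      else Top)"
  by (simp add: position_def descend_child parent_eq)

lemma rank_child: "child w v \<Longrightarrow> rank w = (if position w = Top then Suc (rank v) else rank v)"
  by (simp add: rank_def descend_child)

text \<open>
  The vertex \<open>v\<close> is in the bags of the gaps \<open>lo v, \<dots>, hi v\<close>, where gap \<open>g\<close> lies between
  the leaves \<open>g - 1\<close> and \<open>g\<close>. The leaves \<open>t\<close> with \<open>lo v \<le> t < hi v\<close> are those owned by \<open>v\<close>: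
  they are below \<open>v\<close> but not below the vertices next to \<open>v\<close> further down its spine. Along a spine
  these intervals of leaves follow each other without a break, so neighbours on a spine share
  exactly one gap.
\<close>

definition lo :: "'a \<Rightarrow> nat" where
  "lo v = (if position v \<noteq> Right \<and> Suc (a v) < b v then b (child_towards v (a v)) else a v)"

definition hi :: "'a \<Rightarrow> nat" where
  "hi v = (if position v \<noteq> Left \<and> Suc (a v) < b v then a (child_towards v (b v - 1)) else b v)"

lemma child_position_cases:
  assumes "child w v"
  obtains (left) "position w = Left" "a w = a v" "position v \<noteq> Right" "child_towards v (a v) = w"
      "b w < b v" "rank w = rank v"
    | (right) "position w = Right" "b w = b v" "position v \<noteq> Left" "child_towards v (b v - 1) = w"
      "a v < a w" "rank w = rank v"
    | (top) "position w = Top" "a w = a v \<longrightarrow> position v = Right" "b w = b v \<longrightarrow> position v = Left"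
      "rank w = Suc (rank v)"
proof -
  note D = childD[OF assms]
  consider "position w = Left" | "position w = Right" | "position w = Top"
    by (cases "position w")
  then show thesis
  proof cases
    case 1
    then have "a w = a v" "position v \<noteq> Right"
      using position_child[OF assms] by (auto split: if_splits)
    moreover have "child_towards v (a v) = w"
      using \<open>a w = a v\<close> D by (intro child_towards_eq assms) auto
    ultimately show ?thesis
      using left 1 D rank_child[OF assms] by auto
  next
    case 2
    then have "b w = b v" "position v \<noteq> Left" "a w \<noteq> a v"
      using position_child[OF assms] D by (auto split: if_splits)
    moreover have "child_towards v (b v - 1) = w"
      using \<open>b w = b v\<close> D by (intro child_towards_eq assms) auto
    ultimately show ?thesis
      using right 2 D rank_child[OF assms] by auto
  next
    case 3
    then show ?thesis
      using top position_child[OF assms] rank_child[OF assms] by (auto split: if_splits)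
  qed
qed

lemma first_child:
  assumes "v \<in> W" "Suc (a v) < b v"
  defines "c \<equiv> child_towards v (a v)"
  shows "child c v" "a c = a v" "a v < b c" "b c < b v"
proof -
  show c: "child c v" and "a v < b c"
    using child_towards[of v "a v"] assms by auto
  show "a c = a v"
    using child_towards(2)[of v "a v"] childD(3)[OF c] assms by auto
  with childD[OF c] show "b c < b v" by auto
qed

lemma last_child:
  assumes "v \<in> W" "Suc (a v) < b v"
  defines "c \<equiv> child_towards v (b v - 1)"
  shows "child c v" "b c = b v" "a c < b v" "a v < a c"
proof -
  show c: "child c v"
    using child_towards[of v "b v - 1"] assms by auto
  show "b c = b v"
    using child_towards(3)[OF assms(1,2), of "b v - 1"] childD(4)[OF c] assms(2)
    unfolding c_def by linarith
  with childD(3,5,7)[OF c] show "a c < b v" "a v < a c"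
    by (simp, cases "a c = a v") auto
qed

lemma first_last_child:
  assumes "v \<in> W" "Suc (a v) < b v"
  shows "b (child_towards v (a v)) \<le> a (child_towards v (b v - 1))"
proof -
  note f = first_child[OF assms] and l = last_child[OF assms]
  have "child_towards v (a v) \<noteq> child_towards v (b v - 1)" using f l by auto
  from children_disjoint[OF f(1) l(1) this] show ?thesis
    using f l by auto
qed

text \<open>
  Owning no leaf forces both branches of a spine to leave \<open>v\<close>, towards adjacent children,
  because on a single branch the strictly smaller child leaves some leaf to \<open>v\<close>.
\<close>

lemma lo_hi:
  assumes "v \<in> W"
  shows "a v \<le> lo v" "lo v \<le> hi v" "hi v \<le> b v"
    "lo v = hi v \<Longrightarrow> position v = Top \<and> Suc (a v) < b v \<and> a v < lo v \<and> hi v < b v \<and>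
       b (child_towards v (a v)) = lo v \<and> a (child_towards v (b v - 1)) = lo v"
proof -
  have "a v \<le> lo v \<and> lo v \<le> hi v \<and> hi v \<le> b v \<and>
    (lo v = hi v \<longrightarrow> position v = Top \<and> Suc (a v) < b v \<and> a v < lo v \<and> hi v < b v \<and>
       b (child_towards v (a v)) = lo v \<and> a (child_towards v (b v - 1)) = lo v)"
  proof (cases "Suc (a v) < b v")
    case True
    then show ?thesis
      using first_child[OF assms True] last_child[OF assms True] first_last_child[OF assms True]
      by (cases "position v") (auto simp: lo_def hi_def)
  qed (use nonempty[OF assms] in \<open>auto simp: lo_def hi_def\<close>)
  then show "a v \<le> lo v" "lo v \<le> hi v" "hi v \<le> b v"
    "lo v = hi v \<Longrightarrow> position v = Top \<and> Suc (a v) < b v \<and> a v < lo v \<and> hi v < b v \<and>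
       b (child_towards v (a v)) = lo v \<and> a (child_towards v (b v - 1)) = lo v"
    by blast+
qed

lemma lo_less_hi: "v \<in> W \<Longrightarrow> position v \<noteq> Top \<Longrightarrow> lo v < hi v"
  using lo_hi(2,4)[of v] by (auto simp: le_less)

text \<open>
  A child that starts a new spine hangs off its parent beside the spine of the parent,
  so all its leaves are owned by the parent.
\<close>

lemma top_child_within:
  assumes c: "child w v" "position w = Top"
  shows "lo v \<le> a w" "b w \<le> hi v"
proof -
  note D = childD[OF c(1)]
  note f = first_child[OF D(2,6)] and l = last_child[OF D(2,6)]
  have ends: "a w = a v \<longrightarrow> position v = Right" "b w = b v \<longrightarrow> position v = Left"
    using c(2) child_position_cases[OF c(1)] by force+
  show "lo v \<le> a w"
  proof (cases "position v = Right")
    case False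
    then have "child_towards v (a v) \<noteq> w" using ends f(2) by auto
    from children_disjoint[OF f(1) c(1) this] False show ?thesis
      using f D by (auto simp: lo_def)
  qed (use D in \<open>simp add: lo_def\<close>)
  show "b w \<le> hi v"
  proof (cases "position v = Left")
    case False
    then have "child_towards v (b v - 1) \<noteq> w" using ends l(2) by auto
    from children_disjoint[OF l(1) c(1) this] False show ?thesis
      using l D by (auto simp: hi_def)
  qed (use D in \<open>simp add: hi_def\<close>)
qed

lemma child_towards_owned_leaf:
  assumes "child w v" "a w \<le> t" "t < b w" "lo v \<le> t" "t < hi v"
  shows "position w = Top"
  using assms(1)
proof (cases rule: child_position_cases)
  case left
  then show ?thesis using assms childD(6)[OF assms(1)] by (simp add: lo_def)
next
  case right
  then show ?thesis using assms childD(6)[OF assms(1)] by (simp add: hi_def)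
qed

lemma rank_below: "below w v \<Longrightarrow> rank v \<le> rank w"
proof (induction "m - width w" arbitrary: w rule: less_induct)
  case less
  then have w: "child w (parent w)"
    using not_below_root by (intro child_parent) (auto simp: below_def)
  have "m - width (parent w) < m - width w"
    using childD[OF w] bounded[of "parent w"] by (simp add: width_def)
  have rk: "rank (parent w) \<le> rank w" using rank_child[OF w] by simp
  show ?case
  proof (cases "parent w = v")
    case False
    have "below v (parent w) \<or> below (parent w) v"
      using False less.prems w nonempty[of w]
      by (intro overlap_nested[of _ _ "a w"]) (auto simp: child_def below_def)
    then have "below (parent w) v" using w less.prems by (auto simp: child_def)
    then show ?thesis using less.hyps \<open>m - width (parent w) < m - width w\<close> rk by fastforce
  qed (use rk in simp)
qed

text \<open>
  From the owner \<open>v\<close> of a leaf, the next step down to this leaf starts a new spine. So every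
  descendant of \<open>v\<close> above this leaf has a greater rank.
\<close>

lemma no_owner_below:
  assumes "below w v" "rank v = rank w" "lo v \<le> t" "t < hi v" "a w \<le> t" "t < b w"
  shows False
proof -
  have W: "v \<in> W" "w \<in> W" and av: "a v \<le> t" "t < b v" and "Suc (a v) < b v"
    using assms(1,5,6) below_width[OF assms(1)] nonempty[of w] by (auto simp: below_def width_def)
  then have u: "child (child_towards v t) v" "a (child_towards v t) \<le> t" "t < b (child_towards v t)"
    using child_towards by auto
  let ?u = "child_towards v t"
  have "rank ?u = Suc (rank v)"
    using rank_child[OF u(1)] child_towards_owned_leaf[OF u assms(3,4)] by simp
  moreover have "rank ?u \<le> rank w"
  proof (cases "w = ?u")
    case False
    then have "below w ?u \<or> below ?u w"
      using W(2) childD(1)[OF u(1)] assms(5,6) u(2,3) by (intro overlap_nested) auto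
    then have "below w ?u" using u(1) assms(1) by (auto simp: child_def)
    then show ?thesis by (rule rank_below)
  qed simp
  ultimately show False using assms(2) by simp
qed

lemma owner_unique:
  assumes "v \<in> W" "w \<in> W" "rank v = rank w"
    and t: "lo v \<le> t" "t < hi v" "lo w \<le> t" "t < hi w"
  shows "v = w"
proof (rule ccontr)
  assume "v \<noteq> w"
  have tt: "a v \<le> t" "t < b v" "a w \<le> t" "t < b w"
    using lo_hi(1,3)[OF assms(1)] lo_hi(1,3)[OF assms(2)] t by auto
  from overlap_nested[OF assms(1,2) \<open>v \<noteq> w\<close> tt] show False
    using no_owner_below[of v w t] no_owner_below[of w v t] assms(3) t tt by auto
qed

lemma child_lo_hi:
  assumes c: "child w v"
  shows "lo v \<le> hi w" "lo w \<le> hi v"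
proof -
  note D = childD[OF c]
  have "lo v \<le> hi w \<and> lo w \<le> hi v"
    using c
  proof (cases rule: child_position_cases)
    case left
    then have "lo v = b w" "hi w = b w" using D by (auto simp: lo_def hi_def)
    then show ?thesis using lo_hi(2)[OF D(1)] lo_hi(2)[OF D(2)] by linarith
  next
    case right
    then have "hi v = a w" "lo w = a w" using D by (auto simp: lo_def hi_def)
    then show ?thesis using lo_hi(2)[OF D(1)] lo_hi(2)[OF D(2)] by linarith
  next
    case top
    then show ?thesis using top_child_within[OF c] lo_hi[OF D(1)] D(5) by linarith
  qed
  then show "lo v \<le> hi w" "lo w \<le> hi v" by auto
qed

text \<open>
  The shift by one makes room for the vertices that own no leaf: they move to the level
  of their parent, and the root, if it is one of them, to level 0.
\<close>

definition level :: "'a \<Rightarrow> nat" where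
  "level v = (if lo v < hi v then Suc (rank v) else rank v)"

lemma child_level:
  assumes c: "child w v"
  shows "level v \<le> Suc (level w)" "level w \<le> Suc (level v)"
proof -
  note D = childD[OF c]
  have "level v \<le> Suc (level w) \<and> level w \<le> Suc (level v)"
    using c
  proof (cases rule: child_position_cases)
    case top
    then have "lo v < hi v" using top_child_within[OF c] D(5) by linarith
    with top show ?thesis by (simp add: level_def)
  qed (use lo_less_hi[OF D(1)] in \<open>simp_all add: level_def\<close>)
  then show "level v \<le> Suc (level w)" "level w \<le> Suc (level v)" by auto
qed

lemma leaf_lo_hi_level:
  assumes "i < m"
  shows "lo (leaf i) = i" "hi (leaf i) = Suc i" "level (leaf i) = Suc (rank (leaf i))"
  using leaf[OF assms] by (simp_all add: lo_def hi_def level_def)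

lemma single_leaf:
  assumes "v \<in> W" "\<not> Suc (a v) < b v"
  shows "v = leaf (a v)" "b v = Suc (a v)"
proof -
  show b: "b v = Suc (a v)" using nonempty[OF assms(1)] assms(2) by simp
  then have "a v < m" using bounded[OF assms(1)] by simp
  then show "v = leaf (a v)" using leaf[of "a v"] b by (intro inj assms(1)) auto
qed

text \<open>
  Unless \<open>v\<close> is on a left branch, the descent to its last leaf follows the right branch of
  its spine, and so the rank does not change.
\<close>

lemma rank_last_leaf:
  "v \<in> W \<Longrightarrow> position v \<noteq> Left \<Longrightarrow> rank (leaf (b v - 1)) = rank v"
proof (induction "width v" arbitrary: v rule: less_induct)
  case less
  show ?case
  proof (cases "Suc (a v) < b v")
    case True
    note l = last_child[OF less.prems(1) True]
    have "position (child_towards v (b v - 1)) = Right"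
      using position_child[OF l(1)] l less.prems(2) by simp
    then show ?thesis
      using less.hyps[of "child_towards v (b v - 1)"] childD(1,8)[OF l(1)] rank_child[OF l(1)] l(2)
      by simp
  qed (use single_leaf[OF less.prems(1)] in simp)
qed

lemma rank_first_leaf:
  "v \<in> W \<Longrightarrow> position v \<noteq> Right \<Longrightarrow> rank (leaf (a v)) = rank v"
proof (induction "width v" arbitrary: v rule: less_induct)
  case less
  show ?case
  proof (cases "Suc (a v) < b v")
    case True
    note f = first_child[OF less.prems(1) True]
    have "position (child_towards v (a v)) = Left"
      using position_child[OF f(1)] f less.prems(2) by simp
    then show ?thesis
      using less.hyps[of "child_towards v (a v)"] childD(1,8)[OF f(1)] rank_child[OF f(1)] f(2)
      by simp
  qed (use single_leaf[OF less.prems(1)] in simp)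
qed

text \<open>
  At most one new spine starts on the way from \<open>v\<close> to an end of the interval of its child: either at the child
  itself or, if the child is on the branch towards the opposite end, one step later.
  After that, the end of the interval is also the end of the spine.
\<close>

lemma rank_end_leaves_of_child:
  assumes c: "child w v"
  shows "rank (leaf (b w - 1)) \<in> {rank v, Suc (rank v)}" "rank (leaf (a w)) \<in> {rank v, Suc (rank v)}"
proof -
  note D = childD[OF c]
  show "rank (leaf (b w - 1)) \<in> {rank v, Suc (rank v)}"
  proof (cases "position w = Left")
    case True
    show ?thesis
    proof (cases "Suc (a w) < b w")
      case nl: True
      note l = last_child[OF D(1) nl]
      have "position (child_towards w (b w - 1)) = Top"
        using position_child[OF l(1)] l True by simp
      then show ?thesis
        using rank_last_leaf[OF childD(1)[OF l(1)]] l(2) rank_child[OF l(1)] rank_child[OF c] True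
        by simp
    next
      case False
      then show ?thesis using single_leaf[OF D(1)] rank_child[OF c] True by simp
    qed
  next
    case False
    then show ?thesis using rank_last_leaf[OF D(1)] rank_child[OF c] by simp
  qed
  show "rank (leaf (a w)) \<in> {rank v, Suc (rank v)}"
  proof (cases "position w = Right")
    case True
    show ?thesis
    proof (cases "Suc (a w) < b w")
      case nl: True
      note f = first_child[OF D(1) nl]
      have "position (child_towards w (a w)) = Top"
        using position_child[OF f(1)] f True by simp
      then show ?thesis
        using rank_first_leaf[OF childD(1)[OF f(1)]] f(2) rank_child[OF f(1)] rank_child[OF c] True
        by simp
    next
      case False
      then show ?thesis using single_leaf[OF D(1)] rank_child[OF c] True by simp
    qed
  next
    case False
    then show ?thesis using rank_first_leaf[OF D(1)] rank_child[OF c] by simp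
  qed
qed

lemma consecutive_leaf_levels:
  assumes "Suc t < m"
  shows "level (leaf t) \<le> Suc (level (leaf (Suc t)))" "level (leaf (Suc t)) \<le> Suc (level (leaf t))"
proof -
  \<comment> \<open>The lowest common ancestor \<open>w\<close> of the two leaves: they end the intervals of two of its children.\<close>
  define P where "P w \<longleftrightarrow> w \<in> W \<and> a w \<le> t \<and> Suc t < b w" for w
  define w where "w = arg_min width P"
  have "P root" using assms by (simp add: P_def root)
  from arg_min_nat_lemma[of P, OF this, of width]
  have w: "w \<in> W" "a w \<le> t" "Suc t < b w" and min: "\<And>u. P u \<Longrightarrow> width w \<le> width u"
    by (auto simp: w_def P_def)
  have nl: "Suc (a w) < b w" using w by simp
  let ?c = "child_towards w t" and ?d = "child_towards w (Suc t)"
  have c: "child ?c w" "a ?c \<le> t" "t < b ?c" and d: "child ?d w" "a ?d \<le> Suc t" "Suc t < b ?d"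
    using child_towards[OF w(1) nl, of t] child_towards[OF w(1) nl, of "Suc t"] w by auto
  have "\<not> P ?c" "\<not> P ?d"
    using min[of ?c] min[of ?d] childD(8)[OF c(1)] childD(8)[OF d(1)] by auto
  then have "b ?c = Suc t" "a ?d = Suc t"
    using c d childD(1)[OF c(1)] childD(1)[OF d(1)] by (auto simp: P_def)
  then have "rank (leaf t) \<in> {rank w, Suc (rank w)}" "rank (leaf (Suc t)) \<in> {rank w, Suc (rank w)}"
    using rank_end_leaves_of_child(1)[OF c(1)] rank_end_leaves_of_child(2)[OF d(1)] by auto
  then show "level (leaf t) \<le> Suc (level (leaf (Suc t)))" "level (leaf (Suc t)) \<le> Suc (level (leaf t))"
    using assms by (auto simp: leaf_lo_hi_level)
qed

lemma end_leaf_levels: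
  assumes "0 < m"
  shows "level (leaf 0) = 1" "level (leaf (m - 1)) = 1"
  using rank_first_leaf[OF root(1)] rank_last_leaf[OF root(1)] assms
  by (auto simp: position_root rank_root root leaf_lo_hi_level)

lemma level_root: "level root \<le> 1"
  by (simp add: level_def rank_root)

text \<open>
  A vertex that owns no leaf is the lowest common ancestor of the leaves at its gap: the gap
  separates two of its children, so no smaller interval contains both leaves.
\<close>

lemma gap_vertex_unique:
  assumes "v \<in> W" "w \<in> W" "lo v = g" "hi v = g" "lo w = g" "hi w = g"
  shows "v = w"
proof -
  have aux: False if "below w v" "v \<in> W" "w \<in> W" "lo v = g" "hi v = g" "lo w = g" "hi w = g" for v w
  proof -
    have v: "Suc (a v) < b v" "b (child_towards v (a v)) = g" "a (child_towards v (b v - 1)) = g"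
      using lo_hi(4)[OF that(2)] that by auto
    have w: "a w < g" "g < b w" using lo_hi(4)[OF that(3)] that by auto
    define u where "u = child_towards v (a w)"
    have aw: "a v \<le> a w" "a w < b v" using that(1) nonempty[OF that(3)] by (auto simp: below_def)
    have u: "child u v" "a u \<le> a w" "a w < b u"
      using child_towards[OF that(2) v(1) aw] by (auto simp: u_def)
    have "b w \<le> b u"
    proof (cases "w = u")
      case False
      then have "below w u \<or> below u w"
        using that(3) childD(1)[OF u(1)] u(2,3) nonempty[OF that(3)]
        by (intro overlap_nested[of w u "a w"]) auto
      then show ?thesis using u(1) that(1) by (auto simp: child_def below_def)
    qed simp
    note f = first_child[OF that(2) v(1)] and l = last_child[OF that(2) v(1)]
    have "u = child_towards v (a v)"
      using children_disjoint[OF u(1) f(1)] u w v f \<open>b w \<le> b u\<close> childD(3)[OF u(1)] by fastforce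
    then show False using v(2) \<open>b w \<le> b u\<close> w by simp
  qed
  show ?thesis
  proof (rule ccontr)
    assume "v \<noteq> w"
    have "a v \<le> g" "g < b v" "a w \<le> g" "g < b w"
      using lo_hi[OF assms(1)] lo_hi[OF assms(2)] assms by auto
    from overlap_nested[OF assms(1,2) \<open>v \<noteq> w\<close> this] show False
      using aux[of v w] aux[of w v] assms by blast
  qed
qed

lemma level_0_imp_root:
  assumes "v \<in> W" "level v = 0"
  shows "v = root"
proof (rule ccontr)
  assume "v \<noteq> root"
  have "rank v = 0" "\<not> lo v < hi v" using assms(2) by (auto simp: level_def split: if_splits)
  then have "position v = Top" using lo_less_hi[OF assms(1)] by auto
  then show False
    using rank_child[OF child_parent[OF assms(1) \<open>v \<noteq> root\<close>]] \<open>rank v = 0\<close> by simp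
qed

text \<open>
  If a vertex \<open>v\<close> without leaves of its own was moved to this level, its parent owns both leaves at
  the gap and is the only other vertex. Otherwise every vertex in question owns one of the two
  leaves, and each leaf has at most one owner of the given rank.
\<close>

lemma card_bag_level_le_2: "card {v \<in> W. level v = j \<and> lo v \<le> g \<and> g \<le> hi v} \<le> 2"
  (is "card ?S \<le> 2")
proof (cases "\<exists>v\<in>?S. v \<noteq> root \<and> lo v = hi v")
  case True
  then obtain v where v: "v \<in> W" "level v = j" "v \<noteq> root" "lo v = g" "hi v = g" by auto
  define p where "p = parent v"
  have c: "child v p" using child_parent[OF v(1,3)] by (simp add: p_def)
  have g: "position v = Top" "a v < g" "g < b v"
    using lo_hi(4)[OF v(1)] v by auto
  have j: "j = Suc (rank p)"
    using rank_child[OF c] g v by (auto simp: level_def)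
  have p: "lo p \<le> a v" "b v \<le> hi p" using top_child_within[OF c g(1)] by auto
  have "?S \<subseteq> {p, v}"
  proof
    fix u assume u: "u \<in> ?S"
    show "u \<in> {p, v}"
    proof (cases "lo u = hi u")
      case True
      then have "u = v" using u v by (intro gap_vertex_unique[of u v g]) auto
      then show ?thesis by simp
    next
      case False
      then have lt: "lo u < hi u" using lo_hi(2)[of u] u by auto
      then have rk: "rank u = rank p" using u j by (auto simp: level_def)
      have W: "u \<in> W" "p \<in> W" using u childD(2)[OF c] by auto
      have "u = p"
      proof (cases "g < hi u")
        case True
        then show ?thesis using owner_unique[OF W rk, of g] u p g by auto
      next
        case False
        then show ?thesis using owner_unique[OF W rk, of "g - 1"] u p g lt by auto
      qed
      then show ?thesis by simp
    qed
  qed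
  then have "card ?S \<le> card {p, v}" by (rule card_mono[rotated]) simp
  also have "\<dots> \<le> 2" by (simp add: card_insert_if)
  finally show ?thesis .
next
  case False
  show ?thesis
  proof (cases "j = 0")
    case True
    then have "?S \<subseteq> {root}" using level_0_imp_root by auto
    then have "card ?S \<le> card {root}" by (rule card_mono[rotated]) simp
    then show ?thesis by simp
  next
    case j: False
    have lt: "lo u < hi u" if "u \<in> ?S" for u
    proof (cases "u = root")
      case True
      then show ?thesis using that j rank_root by (auto simp: level_def split: if_splits)
    next
      case False
      then show ?thesis using \<open>\<not> (\<exists>v\<in>?S. _ v)\<close> that lo_hi(2)[of u] by (auto simp: le_less)
    qed
    \<comment> \<open>The boolean tells which of the leaves \<open>g\<close> and \<open>g - 1\<close> is owned.\<close>
    have "inj_on (\<lambda>u. g < hi u) ?S"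
    proof (rule inj_onI)
      fix u w assume u: "u \<in> ?S" and w: "w \<in> ?S" and eq: "(g < hi u) = (g < hi w)"
      have rk: "rank u = rank w" using lt[OF u] lt[OF w] u w by (auto simp: level_def)
      have W: "u \<in> W" "w \<in> W" using u w by auto
      show "u = w"
      proof (cases "g < hi u")
        case True
        then show ?thesis using owner_unique[OF W rk, of g] u w eq by auto
      next
        case False
        then show ?thesis using owner_unique[OF W rk, of "g - 1"] u w eq lt[OF u] lt[OF w] by auto
      qed
    qed
    from card_inj_on_le[OF this, of UNIV] show ?thesis by simp
  qed
qed

end

section \<open>Rooted trees\<close>

definition links :: "'a set set \<Rightarrow> 'a set \<Rightarrow> ('a \<times> 'a) set" where
  "links T S = {(x, y). {x, y} \<in> T \<and> x \<in> S \<and> y \<in> S}"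

lemma links_sym: "(x, y) \<in> (links T S)\<^sup>* \<Longrightarrow> (y, x) \<in> (links T S)\<^sup>*"
  by (rule symD[OF sym_rtrancl]) (auto simp: sym_def links_def insert_commute)

lemma links_mono: "(x, y) \<in> (links T S)\<^sup>* \<Longrightarrow> S \<subseteq> S' \<Longrightarrow> (x, y) \<in> (links T S')\<^sup>*"
  using rtrancl_mono[of "links T S" "links T S'"] by (auto simp: links_def)

lemma links_rtrancl_in: "(x, y) \<in> (links T S)\<^sup>* \<Longrightarrow> x \<in> S \<Longrightarrow> y \<in> S"
  by (induction rule: rtrancl_induct) (auto simp: links_def)

lemma rtrancl_distinct_list:
  assumes "(u, w) \<in> R\<^sup>*"
  shows "\<exists>vs. vs \<noteq> [] \<and> hd vs = u \<and> last vs = w \<and> distinct vs \<and>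
    (\<forall>i. Suc i < length vs \<longrightarrow> (vs ! i, vs ! Suc i) \<in> R)"
  using assms
proof (induction rule: rtrancl_induct)
  case base
  show ?case by (intro exI[of _ "[u]"]) simp
next
  case (step y z)
  then obtain vs where vs: "vs \<noteq> []" "hd vs = u" "last vs = y" "distinct vs"
    "\<forall>i. Suc i < length vs \<longrightarrow> (vs ! i, vs ! Suc i) \<in> R" by blast
  show ?case
  proof (cases "z \<in> set vs")
    case True
    then obtain k where k: "k < length vs" "vs ! k = z" by (auto simp: in_set_conv_nth)
    have "length (take (Suc k) vs) = Suc k" using k(1) by simp
    then show ?thesis
      by (intro exI[of _ "take (Suc k) vs"])
         (use vs k in \<open>auto simp: last_conv_nth hd_conv_nth\<close>)
  next
    case False
    have "(\<forall>i. Suc i < length (vs @ [z]) \<longrightarrow> ((vs @ [z]) ! i, (vs @ [z]) ! Suc i) \<in> R)"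
    proof (intro allI impI)
      fix i assume i: "Suc i < length (vs @ [z])"
      show "((vs @ [z]) ! i, (vs @ [z]) ! Suc i) \<in> R"
      proof (cases "Suc i < length vs")
        case True
        then show ?thesis using vs(5) by (simp add: nth_append)
      next
        case False
        then have "i = length vs - 1" "Suc i = length vs" using i by auto
        then show ?thesis using vs(1,3) step.hyps(2) by (simp add: nth_append last_conv_nth)
      qed
    qed
    then show ?thesis using vs False by (intro exI[of _ "vs @ [z]"]) auto
  qed
qed

text \<open>
  A connection that avoids the edge contains a path that does, and the edge closes this path to a cycle.
\<close>

lemma acyclic_graph_bridge:
  assumes "acyclic_graph T" "{v, w} \<in> T" "v \<noteq> w"
  shows "(v, w) \<notin> {(x, y). {x, y} \<in> T \<and> {x, y} \<noteq> {v, w}}\<^sup>*"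
proof
  assume "(v, w) \<in> {(x, y). {x, y} \<in> T \<and> {x, y} \<noteq> {v, w}}\<^sup>*"
  from rtrancl_distinct_list[OF this] obtain vs where vs: "vs \<noteq> []" "hd vs = v" "last vs = w"
    "distinct vs" and st: "\<And>i. Suc i < length vs \<Longrightarrow> {vs ! i, vs ! Suc i} \<in> T \<and> {vs ! i, vs ! Suc i} \<noteq> {v, w}"
    by auto
  have ends: "vs ! 0 = v" "vs ! (length vs - 1) = w"
    using vs by (auto simp: hd_conv_nth last_conv_nth)
  have "length vs \<noteq> 1" using ends assms(3) by auto
  moreover have "length vs \<noteq> 2" using ends st[of 0] by (auto simp: numeral_2_eq_2)
  moreover have "length vs \<noteq> 0" using vs(1) by simp
  ultimately have len: "3 \<le> length vs" by linarith
  have "cycle_edges vs \<subseteq> T"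
  proof
    fix e assume "e \<in> cycle_edges vs"
    then obtain i where i: "i < length vs" "e = {vs ! i, vs ! (Suc i mod length vs)}"
      by (auto simp: cycle_edges_def)
    show "e \<in> T"
    proof (cases "Suc i < length vs")
      case True
      then show ?thesis using st i by simp
    next
      case False
      then have "Suc i = length vs" "i = length vs - 1" using i by auto
      then show ?thesis using i ends assms(2) by (simp add: insert_commute)
    qed
  qed
  then show False using assms(1) len vs(4) by (auto simp: acyclic_graph_def)
qed

lemma simple_graph_edge:
  assumes "simple_graph V T" "{x, y} \<in> T"
  shows "x \<in> V" "y \<in> V" "x \<noteq> y"
  using assms by (auto simp: simple_graph_def)

lemma vdegree_eq_card_neighbours:
  assumes "simple_graph V T"
  shows "vdegree T v = card {x. {v, x} \<in> T}"
proof -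
  have "bij_betw (\<lambda>x. {v, x}) {x. {v, x} \<in> T} {e \<in> T. v \<in> e}"
  proof (rule bij_betw_imageI)
    show "inj_on (\<lambda>x. {v, x}) {x. {v, x} \<in> T}"
      by (auto simp: inj_on_def doubleton_eq_iff)
    have "\<exists>x. e = {v, x}" if "e \<in> T" "v \<in> e" for e
    proof -
      have "card e = 2" using assms that by (auto simp: simple_graph_def)
      then show ?thesis using that(2) by (auto simp: card_2_iff)
    qed
    then show "(\<lambda>x. {v, x}) ` {x. {v, x} \<in> T} = {e \<in> T. v \<in> e}" by fast
  qed
  then show ?thesis by (simp add: vdegree_def bij_betw_same_card)
qed

lemma leaf_neighbour_unique:
  assumes "simple_graph V T" "v \<in> leaves V T" "{v, x} \<in> T" "{v, y} \<in> T"
  shows "x = y"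
proof -
  have "card {x. {v, x} \<in> T} = 1"
    using assms(2) vdegree_eq_card_neighbours[OF assms(1), of v] by (simp add: leaves_def)
  then obtain z where "{x. {v, x} \<in> T} = {z}" by (auto simp: card_1_singleton_iff)
  then have "x \<in> {z}" "y \<in> {z}" using assms(3,4) by blast+
  then show ?thesis by simp
qed

locale rooted_tree =
  fixes V :: "'a set" and T :: "'a set set" and r :: 'a
  assumes tree: "tree_graph V T"
    and no_degree_2: "v \<in> V \<Longrightarrow> vdegree T v \<noteq> 2"
    and r: "r \<in> V"
begin

lemma simple: "simple_graph V T" and acyclic: "acyclic_graph T"
  and connected: "u \<in> V \<Longrightarrow> v \<in> V \<Longrightarrow> (u, v) \<in> {(x, y). {x, y} \<in> T}\<^sup>*"
  using tree by (auto simp: tree_graph_def connected_graph_def)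

lemmas edgeD = simple_graph_edge[OF simple]

lemma finite_V: "finite V"
  using simple by (simp add: simple_graph_def)

text \<open>
  The vertices that can be reached from \<open>r\<close> without entering \<open>v\<close>. The descendants of \<open>v\<close> are
  the others. This makes both sets connected: walks from \<open>r\<close> to a descendant stay among the
  descendants after their last visit to \<open>v\<close>.
\<close>

inductive_set outer :: "'a \<Rightarrow> 'a set" for v where
  outer_root: "r \<in> outer v"
| outer_step: "x \<in> outer v \<Longrightarrow> {x, y} \<in> T \<Longrightarrow> y \<noteq> v \<Longrightarrow> y \<in> outer v"

definition desc :: "'a \<Rightarrow> 'a set" where
  "desc v = V - outer v"

lemma not_outer_self: "v \<noteq> r \<Longrightarrow> v \<notin> outer v"
  by (auto elim: outer.cases)

lemma outer_subset: "outer v \<subseteq> V"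
proof
  show "x \<in> V" if "x \<in> outer v" for x
    using that by (induction) (auto simp: r dest: edgeD)
qed

lemma desc_subset: "desc v \<subseteq> V" by (auto simp: desc_def)

lemma root_not_desc: "r \<notin> desc v"
  by (simp add: desc_def outer_root)

lemma self_desc: "v \<in> V \<Longrightarrow> v \<noteq> r \<Longrightarrow> v \<in> desc v"
  by (simp add: desc_def not_outer_self)

lemma desc_iff: "w \<in> V \<Longrightarrow> w \<in> desc v \<longleftrightarrow> w \<notin> outer v"
  by (simp add: desc_def)

lemma desc_mono:
  assumes "u \<in> desc v"
  shows "desc u \<subseteq> desc v"
proof -
  have "w \<in> outer u" if "w \<in> outer v" for w
    using that
  proof induction
    case (outer_step x y)
    have "y \<noteq> u" using outer.outer_step[OF outer_step.hyps] assms by (auto simp: desc_def)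
    then show ?case using outer_step outer.outer_step by blast
  qed (rule outer_root)
  then show ?thesis by (auto simp: desc_def)
qed

text \<open>
  A walk from \<open>r\<close> enters one of two distinct vertices before the other.
\<close>

lemma desc_antisym:
  assumes "u \<in> desc v" "v \<in> desc u"
  shows "u = v"
proof (rule ccontr)
  assume ne: "u \<noteq> v"
  have uv: "u \<in> V" "u \<notin> outer v" "v \<notin> outer u" "u \<noteq> r"
    using assms outer_root[of v] by (auto simp: desc_def)
  have "w \<in> outer u \<and> w \<in> outer v" if "(r, w) \<in> {(x, y). {x, y} \<in> T}\<^sup>*" for w
    using that
  proof (induction rule: rtrancl_induct)
    case (step y z)
    then have "z \<noteq> u" "z \<noteq> v" using uv ne outer_step[of y _ z] by auto
    then show ?case using step by (auto intro: outer_step)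
  qed (simp add: outer_root)
  from this[OF connected[OF r uv(1)]] show False using not_outer_self uv(4) by blast
qed

lemma desc_connected:
  assumes "w \<in> desc v"
  shows "(v, w) \<in> (links T (desc v))\<^sup>*"
proof -
  have "w \<in> outer v \<or> (v, w) \<in> (links T (desc v))\<^sup>*" if "(r, w) \<in> {(x, y). {x, y} \<in> T}\<^sup>*" for w
    using that
  proof (induction rule: rtrancl_induct)
    case (step y z)
    have zV: "z \<in> V" "y \<in> V" using step.hyps(2) edgeD by auto
    show ?case
    proof (cases "z = v \<or> z \<in> outer v")
      case False
      then have y: "y \<notin> outer v" using step.hyps(2) outer_step by blast
      then have "(y, z) \<in> links T (desc v)"
        using False step.hyps(2) zV by (auto simp: links_def desc_def)
      then show ?thesis using step.IH y by (meson rtrancl.rtrancl_into_rtrancl)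
    qed auto
  qed (simp add: outer_root)
  moreover have "w \<in> V" "w \<notin> outer v" using assms by (auto simp: desc_def)
  ultimately show ?thesis using connected[OF r] by blast
qed

lemma outer_connected:
  assumes "w \<in> outer v"
  shows "(r, w) \<in> (links T (outer v))\<^sup>*"
  using assms
proof induction
  case (outer_step x y)
  then have "(x, y) \<in> links T (outer v)" by (auto simp: links_def intro: outer.outer_step)
  then show ?case using outer_step.IH by (rule rtrancl_into_rtrancl[rotated])
qed simp

lemma desc_disjoint:
  assumes "u \<in> V" "v \<in> V" "u \<notin> desc v" "v \<notin> desc u"
  shows "desc u \<inter> desc v = {}"
proof -
  have "w \<in> outer u" if "(v, w) \<in> (links T (desc v))\<^sup>*" for w
    using that
  proof (induction rule: rtrancl_induct)
    case (step y z)
    then have "z \<noteq> u" "{y, z} \<in> T" using assms(3) by (auto simp: links_def)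
    then show ?case using step.IH outer_step by blast
  qed (use assms desc_iff in blast)
  then show ?thesis using desc_connected by (auto simp: desc_def)
qed

lemma parent_exists:
  assumes "v \<in> V" "v \<noteq> r"
  shows "\<exists>x \<in> outer v. {v, x} \<in> T"
proof -
  have "w \<in> outer v \<or> (\<exists>x \<in> outer v. {v, x} \<in> T)" if "(r, w) \<in> {(x, y). {x, y} \<in> T}\<^sup>*" for w
    using that
  proof (induction rule: rtrancl_induct)
    case (step y z)
    show ?case
    proof (cases "y \<in> outer v \<and> z = v")
      case True
      then show ?thesis using step.hyps(2) by (auto simp: insert_commute)
    next
      case False
      then show ?thesis using step outer_step by blast
    qed
  qed (simp add: outer_root)
  then show ?thesis using connected[OF r assms(1)] not_outer_self[OF assms(2)] by blast
qed

lemma links_avoid_edge: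
  assumes "(x, y) \<in> (links T S)\<^sup>*" "v \<notin> S"
  shows "(x, y) \<in> {(x, y). {x, y} \<in> T \<and> {x, y} \<noteq> {v, w}}\<^sup>*"
proof -
  have "links T S \<subseteq> {(x, y). {x, y} \<in> T \<and> {x, y} \<noteq> {v, w}}"
    using assms(2) by (auto simp: links_def doubleton_eq_iff)
  then show ?thesis using assms(1) rtrancl_mono by blast
qed

text \<open>
  Two neighbours of \<open>v\<close> that are reachable from \<open>r\<close> without \<open>v\<close> would lie on a cycle through \<open>v\<close>.
\<close>

lemma parent_unique:
  assumes "v \<noteq> r" "x \<in> outer v" "y \<in> outer v" "{v, x} \<in> T" "{v, y} \<in> T"
  shows "x = y"
proof (rule ccontr)
  assume ne: "x \<noteq> y"
  let ?R = "{(p, q). {p, q} \<in> T \<and> {p, q} \<noteq> {v, x}}"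
  have "(y, x) \<in> (links T (outer v))\<^sup>*"
    using outer_connected[OF assms(2)] links_sym[OF outer_connected[OF assms(3)]]
    by (rule rtrancl_trans[rotated])
  then have "(y, x) \<in> ?R\<^sup>*"
    using links_avoid_edge not_outer_self[OF assms(1)] by blast
  moreover have "(v, y) \<in> ?R" using assms(5) ne by (auto simp: doubleton_eq_iff)
  ultimately have "(v, x) \<in> ?R\<^sup>*" by (rule converse_rtrancl_into_rtrancl[rotated])
  then show False using acyclic_graph_bridge[OF acyclic assms(4) edgeD(3)[OF assms(4)]] by blast
qed

text \<open>
  If neither end separated the other from \<open>r\<close>, the connections of both ends with \<open>r\<close> would
  bypass the edge.
\<close>

lemma edge_desc:
  assumes "{v, w} \<in> T" "v \<noteq> r" "w \<noteq> r"
  shows "v \<in> desc w \<or> w \<in> desc v"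
proof (rule ccontr)
  assume "\<not> ?thesis"
  then have *: "v \<in> outer w" "w \<in> outer v" using edgeD[OF assms(1)] by (auto simp: desc_def)
  let ?R = "{(p, q). {p, q} \<in> T \<and> {p, q} \<noteq> {v, w}}"
  have "(v, r) \<in> ?R\<^sup>*"
    using links_avoid_edge[OF links_sym[OF outer_connected[OF *(1)]], of w v]
      not_outer_self[OF assms(3)] by (simp add: insert_commute)
  moreover have "(r, w) \<in> ?R\<^sup>*"
    using links_avoid_edge[OF outer_connected[OF *(2)], of v w] not_outer_self[OF assms(2)] by simp
  ultimately show False
    using acyclic_graph_bridge[OF acyclic assms(1) edgeD(3)[OF assms(1)]] by (meson rtrancl_trans)
qed

lemma no_desc_between:
  assumes "{v, w} \<in> T" "u \<in> desc v" "w \<in> desc u" "u \<noteq> v"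
  shows "u = w"
proof (rule ccontr)
  assume "u \<noteq> w"
  have "v \<notin> desc u" using desc_antisym assms(2,4) by blast
  then have "v \<in> outer u" using edgeD(1)[OF assms(1)] by (simp add: desc_def)
  then have "w \<in> outer u" using assms(1) \<open>u \<noteq> w\<close> by (auto intro: outer_step)
  then show False using assms(3) by (simp add: desc_def)
qed

text \<open>
  Here the degree condition enters: an inner vertex has degree at least 3, and only
  one neighbour is not a descendant.
\<close>

lemma two_children:
  assumes "v \<in> V" "v \<noteq> r" "v \<notin> leaves V T"
  obtains x y where "x \<noteq> y" "{v, x} \<in> T" "{v, y} \<in> T" "x \<in> desc v" "y \<in> desc v"
proof -
  let ?N = "{x. {v, x} \<in> T}"
  have fin: "finite ?N" by (rule finite_subset[OF _ finite_V]) (auto dest: edgeD)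
  obtain p where p: "p \<in> outer v" "{v, p} \<in> T" using parent_exists assms by blast
  have "card ?N \<noteq> 0" using p fin by auto
  moreover have "card ?N \<noteq> 1" "card ?N \<noteq> 2"
    using assms no_degree_2[of v] vdegree_eq_card_neighbours[OF simple, of v] by (auto simp: leaves_def)
  ultimately have "3 \<le> card ?N" by linarith
  then have "2 \<le> card (?N - {p})" using p by (simp add: card_Diff_singleton)
  then obtain S where S: "S \<subseteq> ?N - {p}" "card S = 2" by (rule obtain_subset_with_card_n)
  obtain x y where "S = {x, y}" "x \<noteq> y" using S(2) unfolding card_2_iff by blast
  then have xy: "x \<noteq> y" "x \<in> ?N - {p}" "y \<in> ?N - {p}" using S(1) by blast+
  moreover have "z \<in> desc v" if "z \<in> ?N - {p}" for z
    using that parent_unique[OF assms(2) p(1) _ p(2), of z] edgeD(2)[of v z] by (auto simp: desc_def)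
  ultimately show thesis using that[of x y] by auto
qed

lemma desc_leaf:
  assumes "v \<in> leaves V T" "v \<noteq> r"
  shows "desc v = {v}"
proof -
  have v: "v \<in> V" using assms(1) by (simp add: leaves_def)
  obtain p where p: "p \<in> outer v" "{v, p} \<in> T" using parent_exists[OF v assms(2)] by blast
  have "w = v" if "w \<in> desc v" for w
    using desc_connected[OF that]
  proof (cases rule: converse_rtranclE)
    case base
    then show ?thesis by simp
  next
    case (step y)
    then have "y = p" using leaf_neighbour_unique[OF simple assms(1) _ p(2)] by (auto simp: links_def)
    then show ?thesis using step(1) p(1) by (auto simp: links_def desc_def)
  qed
  then show ?thesis using self_desc[OF v assms(2)] by auto
qed

lemma leaf_in_desc:
  "v \<in> V \<Longrightarrow> v \<noteq> r \<Longrightarrow> \<exists>l \<in> leaves V T. l \<in> desc v"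
proof (induction "card (desc v)" arbitrary: v rule: less_induct)
  case less
  show ?case
  proof (cases "v \<in> leaves V T")
    case True
    then show ?thesis using self_desc less.prems by blast
  next
    case False
    obtain x where x: "{v, x} \<in> T" "x \<in> desc v"
      using two_children[OF less.prems False] by blast
    have "v \<notin> desc x" using desc_antisym[OF x(2)] edgeD(3)[OF x(1)] by auto
    then have "desc x \<subset> desc v" using desc_mono[OF x(2)] self_desc[OF less.prems] by blast
    then have "card (desc x) < card (desc v)"
      using finite_subset[OF desc_subset finite_V] by (intro psubset_card_mono) auto
    moreover have "x \<in> V" "x \<noteq> r" using x root_not_desc edgeD by auto
    ultimately show ?thesis using less.hyps[of x] \<open>desc x \<subset> desc v\<close> by blast
  qed
qed

text \<open>
  Of two children of \<open>v\<close>, at least one is not above \<open>u\<close>, and the leaves below that child are not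
  below \<open>u\<close>. So distinct vertices have distinct sets of leaves.
\<close>

lemma leaf_separates:
  assumes "v \<in> V" "v \<noteq> r" "u \<in> desc v" "u \<noteq> v"
  shows "\<exists>l \<in> leaves V T. l \<in> desc v \<and> l \<notin> desc u"
proof -
  have "v \<notin> leaves V T" using desc_leaf assms by auto
  from two_children[OF assms(1,2) this]
  obtain x y where xy: "x \<noteq> y" "{v, x} \<in> T" "{v, y} \<in> T" "x \<in> desc v" "y \<in> desc v" .
  have sep: "z \<notin> desc u" if "{v, z} \<in> T" "u \<noteq> z" "u \<in> desc v" "u \<noteq> v" for u z
    using no_desc_between[OF that(1,3) _ that(4)] that(2) by blast
  have "\<exists>z. {v, z} \<in> T \<and> z \<in> desc v \<and> u \<notin> desc z"
  proof (rule ccontr)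
    assume "\<not> ?thesis"
    then have u: "u \<in> desc x" "u \<in> desc y" using xy by auto
    have "desc x \<inter> desc y = {}"
      using sep[of x y] sep[of y x] xy edgeD(2,3)[OF xy(2)] edgeD(2,3)[OF xy(3)]
      by (intro desc_disjoint) auto
    then show False using u by blast
  qed
  then obtain z where z: "{v, z} \<in> T" "z \<in> desc v" "u \<notin> desc z" by blast
  have zV: "z \<in> V" "z \<noteq> r" "u \<in> V"
    using edgeD(2)[OF z(1)] root_not_desc[of v] z(2) desc_subset[of v] assms(3) by auto
  have "u \<noteq> z" using z(3) self_desc[OF zV(1,2)] by auto
  then have "z \<notin> desc u" using assms(3,4) by (intro sep[OF z(1)])
  then have "desc u \<inter> desc z = {}" by (intro desc_disjoint zV z(3))
  moreover obtain l where "l \<in> leaves V T" "l \<in> desc z" using leaf_in_desc[OF zV(1,2)] by blast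
  ultimately show ?thesis using desc_mono[OF z(2)] by (intro bexI[of _ l]) auto
qed

lemma desc_of_root_neighbour:
  assumes "r \<in> leaves V T" "{r, c} \<in> T"
  shows "desc c = V - {r}"
proof -
  have "x = r" if "x \<in> outer c" for x
    using that
  proof induction
    case (outer_step x y)
    then show ?case using leaf_neighbour_unique[OF simple assms(1) assms(2), of y] by auto
  qed simp
  then show ?thesis using outer_root by (auto simp: desc_def)
qed

end

section \<open>Plane trees and the order of their leaves\<close>

text \<open>
  A walk that enters a leaf must go back along the same edge, so leaves in its interior can be skipped.
\<close>

lemma links_avoiding_leaves:
  assumes T: "simple_graph V T" and S: "S \<subseteq> V" "u \<in> S" and uw: "(u, w) \<in> (links T S)\<^sup>*"
  shows "(u, w) \<in> (links T ({u, w} \<union> (S - leaves V T)))\<^sup>*"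
proof -
  let ?N = "insert u (S - leaves V T)"
  have "\<exists>x. (u, x) \<in> (links T ?N)\<^sup>* \<and> (w = x \<or> {x, w} \<in> T)"
    using uw
  proof (induction rule: rtrancl_induct)
    case (step y z)
    then obtain x where x: "(u, x) \<in> (links T ?N)\<^sup>*" "y = x \<or> {x, y} \<in> T" by blast
    have yz: "{y, z} \<in> T" "y \<in> S" using step.hyps(2) by (auto simp: links_def)
    have xN: "x \<in> ?N" using links_rtrancl_in[OF x(1)] by simp
    consider "y = x" | "y \<noteq> x" "{x, y} \<in> T" "y \<in> ?N" | "{x, y} \<in> T" "y \<in> leaves V T"
      using x(2) yz(2) by blast
    then show ?case
    proof cases
      case 1
      then show ?thesis using x(1) yz(1) by blast
    next
      case 2
      then have "(x, y) \<in> links T ?N" using xN by (simp add: links_def)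
      then have "(u, y) \<in> (links T ?N)\<^sup>*" using x(1) by (rule rtrancl_into_rtrancl[rotated])
      then show ?thesis using yz(1) by blast
    next
      case 3
      then have "z = x"
        using leaf_neighbour_unique[OF T 3(2) yz(1), of x] by (simp add: insert_commute)
      then show ?thesis using x(1) by blast
    qed
  qed blast
  then obtain x where x: "(u, x) \<in> (links T ?N)\<^sup>*" "w = x \<or> {x, w} \<in> T" by blast
  have xN: "x \<in> ?N" using links_rtrancl_in[OF x(1)] by simp
  have sub: "?N \<subseteq> {u, w} \<union> (S - leaves V T)" by auto
  show ?thesis
  proof (cases "w = x")
    case True
    then show ?thesis using links_mono[OF x(1) sub] by simp
  next
    case False
    then have "(x, w) \<in> links T ({u, w} \<union> (S - leaves V T))" using x(2) xN by (auto simp: links_def)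
    then show ?thesis using links_mono[OF x(1) sub] by (rule rtrancl_into_rtrancl[rotated])
  qed
qed

definition curves :: "'a set set \<Rightarrow> ('a set \<Rightarrow> real \<Rightarrow> complex) \<Rightarrow> 'a set \<Rightarrow> complex set" where
  "curves T crv S = (\<Union>e \<in> {e \<in> T. e \<subseteq> S}. path_image (crv e))"

lemma path_component_curves:
  assumes emb: "plane_embedding V T pos crv"
    and uw: "(u, w) \<in> (links T S)\<^sup>*" "u \<noteq> w"
  shows "path_component (curves T crv S) (pos u) (pos w)"
proof -
  have edge: "path_component (curves T crv S) (pos x) (pos y)" if "(x, y) \<in> links T S" for x y
  proof -
    let ?c = "crv {x, y}"
    have e: "{x, y} \<in> T" "{x, y} \<subseteq> S" using that by (auto simp: links_def)
    have c: "arc ?c" "{pathstart ?c, pathfinish ?c} = pos ` {x, y}"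
      using emb e(1) by (auto simp: plane_embedding_def)
    have im: "path_image ?c \<subseteq> curves T crv S" using e by (auto simp: curves_def)
    have *: "path_component (curves T crv S) (pathstart ?c) (pathfinish ?c)"
      unfolding path_component_def using c(1) im arc_imp_path by blast
    have "pathstart ?c = pos x \<and> pathfinish ?c = pos y \<or> pathstart ?c = pos y \<and> pathfinish ?c = pos x"
      using c(2) by (auto simp: doubleton_eq_iff)
    then show ?thesis using * path_component_sym by metis
  qed
  have "w = u \<or> path_component (curves T crv S) (pos u) (pos w)"
    using uw(1)
  proof (induction rule: rtrancl_induct)
    case (step y z)
    then show ?case using edge[OF step.hyps(2)] path_component_trans by blast
  qed simp
  then show ?thesis using uw(2) by blast
qed

lemma curves_disjoint:
  assumes emb: "plane_embedding V T pos crv" and "S \<inter> S' = {}"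
  shows "curves T crv S \<inter> curves T crv S' = {}"
proof -
  have "path_image (crv e) \<inter> path_image (crv f) = {}"
    if "e \<in> T" "f \<in> T" "e \<subseteq> S" "f \<subseteq> S'" for e f
  proof (cases "e = f")
    case True
    then have "e = {}" using that assms(2) by blast
    then have "{pathstart (crv e), pathfinish (crv e)} = {}"
      using emb that(1) unfolding plane_embedding_def by (metis image_empty)
    then show ?thesis by simp
  next
    case False
    then have "path_image (crv e) \<inter> path_image (crv f) = pos ` (e \<inter> f)"
      using emb that(1,2) unfolding plane_embedding_def by blast
    moreover have "e \<inter> f = {}" using that(3,4) assms(2) by blast
    ultimately show ?thesis by simp
  qed
  then show ?thesis unfolding curves_def by blast
qed

text \<open>
  The connections can be chosen to pass through no further leaf. Their drawings are then
  disjoint, stay inside the Jordan curve except at the four leaves, and join alternate ones of these.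
\<close>

lemma disjoint_leaf_connections_do_not_interleave:
  assumes T: "simple_graph V T" and emb: "plane_embedding V T pos crv"
    and lo: "leaf_order V T pos crv ls"
    and ijkl: "i < j" "j < k" "k < l" "l < length ls"
    and S: "S \<subseteq> V" "S' \<subseteq> V" "S \<inter> S' = {}"
    and ik: "ls ! i \<in> S" "(ls ! i, ls ! k) \<in> (links T S)\<^sup>*"
    and jl: "ls ! j \<in> S'" "(ls ! j, ls ! l) \<in> (links T S')\<^sup>*"
  shows False
proof -
  obtain g t where g: "simple_path g" "pathfinish g = pathstart g"
    and ins: "drawing V T pos crv - pos ` leaves V T \<subseteq> inside (path_image g)"
    and t: "\<And>i. i < length ls \<Longrightarrow> 0 \<le> t i \<and> t i < (1::real) \<and> g (t i) = pos (ls ! i)"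
    and tmono: "\<And>i j. i < j \<Longrightarrow> j < length ls \<Longrightarrow> t i < t j"
    and ls: "distinct ls" "set ls = leaves V T"
    using lo unfolding leaf_order_def by blast
  have on_g: "pos ` leaves V T \<subseteq> path_image g"
  proof -
    have "pos (ls ! i) \<in> path_image g" if "i < length ls" for i
      using t[OF that] by (force simp: path_image_def)
    then show ?thesis unfolding ls(2)[symmetric] by (auto simp: in_set_conv_nth)
  qed
  have *: "path_component (curves T crv N) (pos u) (pos w)
      \<and> curves T crv N \<inter> path_image g \<subseteq> {pos u, pos w}
      \<and> curves T crv N \<subseteq> inside (path_image g) \<union> path_image g"
    if uw: "R \<subseteq> V" "u \<in> R" "(u, w) \<in> (links T R)\<^sup>*" "u \<noteq> w"
      and N: "N = {u, w} \<union> (R - leaves V T)" for R N u w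
  proof (intro conjI)
    have "(u, w) \<in> (links T N)\<^sup>*"
      unfolding N by (rule links_avoiding_leaves[OF T uw(1-3)])
    then show "path_component (curves T crv N) (pos u) (pos w)"
      using path_component_curves[OF emb] uw(4) by blast
    have dr: "curves T crv N \<subseteq> drawing V T pos crv" by (auto simp: curves_def drawing_def)
    then show "curves T crv N \<subseteq> inside (path_image g) \<union> path_image g" using ins on_g by blast
    show "curves T crv N \<inter> path_image g \<subseteq> {pos u, pos w}"
    proof
      fix x assume x: "x \<in> curves T crv N \<inter> path_image g"
      then have "x \<notin> inside (path_image g)" using inside_no_overlap[of "path_image g"] by blast
      then obtain v where v: "v \<in> leaves V T" "x = pos v" using x dr ins by blast
      have vV: "v \<in> V" using v(1) by (simp add: leaves_def)
      obtain e where e: "e \<in> T" "e \<subseteq> N" "x \<in> path_image (crv e)" using x by (auto simp: curves_def)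
      have "path_image (crv e) \<inter> pos ` V = pos ` e" "inj_on pos V"
        using emb e(1) unfolding plane_embedding_def by blast+
      moreover have "e \<subseteq> V" using T e(1) by (simp add: simple_graph_def)
      ultimately have "v \<in> e" using v vV e(3) by (metis IntI imageI inj_on_image_mem_iff)
      then have "v \<in> {u, w}" using e(2) v(1) N by blast
      then show "x \<in> {pos u, pos w}" using v(2) by blast
    qed
  qed
  define P where "P = {ls ! i, ls ! k} \<union> (S - leaves V T)"
  define Q where "Q = {ls ! j, ls ! l} \<union> (S' - leaves V T)"
  have ne: "ls ! i \<noteq> ls ! k" "ls ! j \<noteq> ls ! l"
    using ijkl ls(1) by (simp_all add: nth_eq_iff_index_eq)
  have inS: "ls ! k \<in> S" "ls ! l \<in> S'"
    using links_rtrancl_in[OF ik(2,1)] links_rtrancl_in[OF jl(2,1)] by auto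
  have "P \<inter> Q = {}" using S(3) ik(1) jl(1) inS by (auto simp: P_def Q_def)
  then have "curves T crv P \<inter> curves T crv Q = {}" by (rule curves_disjoint[OF emb])
  moreover have "curves T crv P \<inter> curves T crv Q \<noteq> {}"
  proof (rule loop_chords_meet[OF g, of "t i" "t j" "t k" "t l"])
    have pos: "g (t i) = pos (ls ! i)" "g (t j) = pos (ls ! j)" "g (t k) = pos (ls ! k)" "g (t l) = pos (ls ! l)"
      using t ijkl by auto
    show "0 \<le> t i" "t l < 1" using t[of i] t[of l] ijkl by auto
    show "t i < t j" "t j < t k" "t k < t l" using tmono ijkl by auto
    show "path_component (curves T crv P) (g (t i)) (g (t k))"
      "curves T crv P \<inter> path_image g \<subseteq> {g (t i), g (t k)}"
      "curves T crv P \<subseteq> inside (path_image g) \<union> path_image g"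
      unfolding pos using *[OF S(1) ik ne(1) P_def] by blast+
    show "path_component (curves T crv Q) (g (t j)) (g (t l))"
      "curves T crv Q \<inter> path_image g \<subseteq> {g (t j), g (t l)}"
      "curves T crv Q \<subseteq> inside (path_image g) \<union> path_image g"
      unfolding pos using *[OF S(2) jl ne(2) Q_def] by blast+
  qed
  ultimately show False by simp
qed

section \<open>Layered path decompositions from intervals\<close>

text \<open>
  The bags are the sets of vertices whose interval \<open>{x v..y v}\<close> contains a given point; the
  layers are the fibres of \<open>L\<close>. By the Helly property on the line, adjacent vertices have a
  common bag if their intervals meet.
\<close>

lemma layered_pathwidth_le_by_intervals:
  fixes x y L :: "'a \<Rightarrow> nat"
  assumes fin: "finite V"
    and xy: "\<And>v. v \<in> V \<Longrightarrow> x v \<le> y v \<and> y v \<le> m"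
    and E: "\<And>e. e \<in> E \<Longrightarrow> \<exists>u w. e = {u, w} \<and> u \<in> V \<and> w \<in> V \<and>
        x u \<le> y w \<and> x w \<le> y u \<and> L u \<le> Suc (L w) \<and> L w \<le> Suc (L u)"
    and wd: "\<And>g j. card {v \<in> V. L v = j \<and> x v \<le> g \<and> g \<le> y v} \<le> k"
  shows "layered_pathwidth V E \<le> k"
proof -
  define B where "B g = {v \<in> V. x v \<le> g \<and> g \<le> y v}" for g
  define Bs where "Bs = map B [0..<Suc m]"
  define N where "N = Suc (Max (insert 0 (L ` V)))"
  define Ls where "Ls = map (\<lambda>j. {v \<in> V. L v = j}) [0..<N]"
  have LN: "L v < N" if "v \<in> V" for v
    using fin that by (simp add: N_def less_Suc_eq_le)
  have Bs: "length Bs = Suc m" "\<And>g. g \<le> m \<Longrightarrow> Bs ! g = B g"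
    by (simp_all add: Bs_def nth_append del: upt_Suc)
  have Ls: "length Ls = N" "\<And>j. j < N \<Longrightarrow> Ls ! j = {v \<in> V. L v = j}"
    by (simp_all add: Ls_def)
  have "path_decomposition V E Bs"
    unfolding path_decomposition_def
  proof (intro conjI ballI)
    show "C \<subseteq> V" if "C \<in> set Bs" for C using that by (auto simp: Bs_def B_def)
    show "\<exists>i j. i \<le> j \<and> {k. k < length Bs \<and> v \<in> Bs ! k} = {i..j}" if "v \<in> V" for v
    proof (intro exI conjI)
      show "x v \<le> y v" using xy[OF that] by simp
      show "{k. k < length Bs \<and> v \<in> Bs ! k} = {x v..y v}"
        using xy[OF that] that by (auto simp: Bs less_Suc_eq_le B_def)
    qed
    show "\<exists>C \<in> set Bs. e \<subseteq> C" if e: "e \<in> E" for e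
    proof -
      obtain u w where uw: "e = {u, w}" "u \<in> V" "w \<in> V" "x u \<le> y w" "x w \<le> y u" using E[OF e] by blast
      have "e \<subseteq> B (max (x u) (x w))" using uw xy by (auto simp: B_def)
      moreover have "max (x u) (x w) \<le> m" using xy uw by (meson le_trans max.boundedI)
      ultimately show ?thesis by (auto simp: Bs_def simp del: upt_Suc)
    qed
  qed
  moreover have "layering V E Ls"
    unfolding layering_def
  proof (intro conjI allI impI ballI)
    show "\<Union> (set Ls) = V" using LN by (auto simp: Ls_def)
    show "Ls ! i \<inter> Ls ! j = {}" if "i < length Ls" "j < length Ls" "i \<noteq> j" for i j
      using that by (auto simp: Ls)
    show "i \<le> Suc j" "j \<le> Suc i" if ij: "i < length Ls" "j < length Ls" and u: "u \<in> Ls ! i" and v: "v \<in> Ls ! j"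
      and e: "{u, v} \<in> E" for i j u v
    proof -
      have "L u = i" "L v = j" using ij u v by (auto simp: Ls)
      then show "i \<le> Suc j" "j \<le> Suc i" using E[OF e] by (auto simp: doubleton_eq_iff)
    qed
  qed
  moreover have "card (C \<inter> L') \<le> k" if C: "C \<in> set Bs" and L': "L' \<in> set Ls" for C L'
  proof -
    obtain g j where "C = B g" "L' = {v \<in> V. L v = j}" using C L' by (auto simp: Bs_def Ls_def)
    then have "C \<inter> L' = {v \<in> V. L v = j \<and> x v \<le> g \<and> g \<le> y v}" by (auto simp: B_def)
    then show ?thesis using wd by simp
  qed
  ultimately show ?thesis unfolding layered_pathwidth_def by (intro Least_le) blast
qed

section \<open>Halin graphs\<close>

lemma convex_nat_set_eq_atLeastLessThan:
  fixes D :: "nat set"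
  assumes "finite D" "D \<noteq> {}" and conv: "\<And>i j k. i \<in> D \<Longrightarrow> k \<in> D \<Longrightarrow> i < j \<Longrightarrow> j < k \<Longrightarrow> j \<in> D"
  shows "D = {Min D..<Suc (Max D)}"
proof (intro equalityI subsetI)
  show "j \<in> {Min D..<Suc (Max D)}" if "j \<in> D" for j
    using that assms(1) by (auto simp: less_Suc_eq_le)
  show "j \<in> D" if "j \<in> {Min D..<Suc (Max D)}" for j
    using that conv[of "Min D" "Max D" j] Min_in[OF assms(1,2)] Max_in[OF assms(1,2)]
    by (cases "j = Min D \<or> j = Max D") auto
qed

text \<open>
  The tree of a Halin graph, rooted at the first leaf \<open>ls ! 0\<close>. The other \<open>m\<close> leaves are
  numbered from 0.
\<close>

locale plane_rooted_tree = rooted_tree V T r for V :: "'a set" and T r +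
  fixes pos :: "'a \<Rightarrow> complex" and crv :: "'a set \<Rightarrow> real \<Rightarrow> complex" and ls :: "'a list" and m :: nat
  assumes embedding: "plane_embedding V T pos crv"
    and leaf_order: "leaf_order V T pos crv ls"
    and length_ls: "length ls = Suc m"
    and first_leaf: "ls ! 0 = r"
begin

definition leaf :: "nat \<Rightarrow> 'a" where
  "leaf i = ls ! Suc i"

lemma distinct_ls: "distinct ls" and set_ls: "set ls = leaves V T"
  using leaf_order by (auto simp: leaf_order_def)

lemma leaves_subset: "leaves V T \<subseteq> V"
  by (auto simp: leaves_def)

lemma root_leaf: "r \<in> leaves V T"
  using nth_mem[of 0 ls] length_ls first_leaf set_ls by simp

lemma leaf_in_leaves:
  assumes "i < m"
  shows "leaf i \<in> leaves V T" "leaf i \<in> V" "leaf i \<noteq> r"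
proof -
  show "leaf i \<in> leaves V T"
    using assms nth_mem[of "Suc i" ls] length_ls set_ls by (simp add: leaf_def)
  then show "leaf i \<in> V" using leaves_subset by blast
  show "leaf i \<noteq> r"
    using assms distinct_ls length_ls
    by (simp add: leaf_def first_leaf[symmetric] nth_eq_iff_index_eq)
qed

lemma leaf_eq_iff: "i < m \<Longrightarrow> j < m \<Longrightarrow> leaf i = leaf j \<longleftrightarrow> i = j"
  using distinct_ls length_ls by (simp add: leaf_def nth_eq_iff_index_eq)

lemma leaf_index:
  assumes "l \<in> leaves V T" "l \<noteq> r"
  obtains i where "i < m" "l = leaf i"
proof -
  obtain i where i: "i < Suc m" "l = ls ! i"
    using assms(1) set_ls length_ls by (metis in_set_conv_nth)
  then obtain j where "i = Suc j" using assms(2) first_leaf by (cases i) auto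
  then show thesis using that[of j] i by (simp add: leaf_def)
qed

definition leaf_indices :: "'a \<Rightarrow> nat set" where
  "leaf_indices v = {i. i < m \<and> leaf i \<in> desc v}"

lemma finite_leaf_indices: "finite (leaf_indices v)"
  by (simp add: leaf_indices_def)

lemma leaf_indices_separate:
  assumes "l \<in> leaves V T" "l \<in> desc v" "l \<notin> desc u"
  shows "\<not> leaf_indices v \<subseteq> leaf_indices u"
proof -
  have "l \<noteq> r" using assms(2) root_not_desc by auto
  then obtain i where "i < m" "l = leaf i" using leaf_index assms(1) by blast
  then have "i \<in> leaf_indices v" "i \<notin> leaf_indices u" using assms by (auto simp: leaf_indices_def)
  then show ?thesis by blast
qed

lemma leaf_indices_nonempty:
  assumes "v \<in> V" "v \<noteq> r"
  shows "leaf_indices v \<noteq> {}"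
proof -
  obtain l where l: "l \<in> leaves V T" "l \<in> desc v" using leaf_in_desc[OF assms] by blast
  have "l \<noteq> r" using l(2) root_not_desc by auto
  then obtain i where "i < m" "l = leaf i" using leaf_index l(1) by blast
  then show ?thesis using l by (auto simp: leaf_indices_def)
qed

text \<open>
  Leaves \<open>i\<close> and \<open>k\<close> are connected below \<open>v\<close>, while \<open>j\<close> is connected with the root outside \<open>desc v\<close>.
  The root precedes all other leaves, so these two pairs would interleave.
\<close>

lemma leaf_indices_convex:
  assumes i: "i \<in> leaf_indices v" and k: "k \<in> leaf_indices v" and ijk: "i < j" "j < k"
  shows "j \<in> leaf_indices v"
proof (rule ccontr)
  assume j: "j \<notin> leaf_indices v"
  have lt: "i < m" "j < m" "k < m" using k ijk by (auto simp: leaf_indices_def)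
  have j': "leaf j \<in> outer v"
    using j lt(2) desc_iff[OF leaf_in_leaves(2)[OF lt(2)], of v] by (simp add: leaf_indices_def)
  have ik': "leaf i \<in> desc v" "leaf k \<in> desc v" using i k by (auto simp: leaf_indices_def)
  show False
  proof (rule disjoint_leaf_connections_do_not_interleave[OF simple embedding leaf_order,
        of 0 "Suc i" "Suc j" "Suc k" "outer v" "desc v"])
    show "outer v \<inter> desc v = {}" by (auto simp: desc_def)
    show "(ls ! 0, ls ! Suc j) \<in> (links T (outer v))\<^sup>*"
      using outer_connected[OF j'] by (simp add: first_leaf leaf_def)
    show "(ls ! Suc i, ls ! Suc k) \<in> (links T (desc v))\<^sup>*"
      using links_sym[OF desc_connected[OF ik'(1)]] desc_connected[OF ik'(2)]
      unfolding leaf_def by (rule rtrancl_trans)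
    show "ls ! 0 \<in> outer v" using outer_root by (simp add: first_leaf)
    show "ls ! Suc i \<in> desc v" using ik'(1) by (simp add: leaf_def)
    show "0 < Suc i" "Suc i < Suc j" "Suc j < Suc k" "Suc k < length ls"
      using ijk lt(3) length_ls by auto
  qed (rule outer_subset desc_subset)+
qed

definition start :: "'a \<Rightarrow> nat" where
  "start v = Min (leaf_indices v)"

definition stop :: "'a \<Rightarrow> nat" where
  "stop v = Suc (Max (leaf_indices v))"

lemma leaf_indices_interval:
  assumes "v \<in> V" "v \<noteq> r"
  shows "leaf_indices v = {start v..<stop v}" "start v < stop v"
proof -
  show *: "leaf_indices v = {start v..<stop v}"
    unfolding start_def stop_def
    by (rule convex_nat_set_eq_atLeastLessThan[OF finite_leaf_indices leaf_indices_nonempty[OF assms]])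
       (rule leaf_indices_convex)
  then show "start v < stop v" using leaf_indices_nonempty[OF assms] by simp
qed

lemma leaf_indices_mono: "u \<in> desc v \<Longrightarrow> leaf_indices u \<subseteq> leaf_indices v"
  using desc_mono by (auto simp: leaf_indices_def)

lemma leaf_indices_disjoint:
  assumes "u \<in> V" "v \<in> V" "u \<notin> desc v" "v \<notin> desc u"
  shows "leaf_indices u \<inter> leaf_indices v = {}"
  using desc_disjoint[OF assms] by (auto simp: leaf_indices_def)

lemma leaf_indices_subset_iff:
  assumes "u \<in> V" "u \<noteq> r" "w \<in> V" "w \<noteq> r"
  shows "leaf_indices w \<subseteq> leaf_indices u \<longleftrightarrow> w \<in> desc u"
proof
  assume sub: "leaf_indices w \<subseteq> leaf_indices u"
  show "w \<in> desc u"
  proof (rule ccontr)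
    assume w: "w \<notin> desc u"
    have "u \<noteq> w" using w self_desc[OF assms(3,4)] by auto
    show False
    proof (cases "u \<in> desc w")
      case True
      then obtain l where "l \<in> leaves V T" "l \<in> desc w" "l \<notin> desc u"
        using leaf_separates[OF assms(3,4) True \<open>u \<noteq> w\<close>] by blast
      then show False using leaf_indices_separate sub by blast
    next
      case False
      then show False
        using leaf_indices_disjoint[OF assms(1,3) False w] sub leaf_indices_nonempty[OF assms(3,4)]
        by blast
    qed
  qed
qed (rule leaf_indices_mono)

lemma desc_iff_interval:
  assumes "u \<in> V" "u \<noteq> r" "w \<in> V" "w \<noteq> r"
  shows "w \<in> desc u \<longleftrightarrow> start u \<le> start w \<and> stop w \<le> stop u"
  using leaf_indices_subset_iff[OF assms] leaf_indices_interval[OF assms(1,2)]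
    leaf_indices_interval[OF assms(3,4)]
  by (simp add: atLeastLessThan_subset_iff)

definition apex :: 'a where
  "apex = (SOME c. {r, c} \<in> T)"

lemma apex_edge: "{r, apex} \<in> T"
proof -
  have "card {x. {r, x} \<in> T} = 1"
    using root_leaf vdegree_eq_card_neighbours[OF simple, of r] by (simp add: leaves_def)
  then have "\<exists>c. {r, c} \<in> T" by (auto simp: card_1_singleton_iff)
  then show ?thesis unfolding apex_def by (rule someI_ex)
qed

lemma apex: "apex \<in> V" "apex \<noteq> r"
  using edgeD(2,3)[OF apex_edge] by auto

lemma leaf_indices_apex: "leaf_indices apex = {0..<m}"
proof -
  have "leaf i \<in> desc apex" if "i < m" for i
    using desc_of_root_neighbour[OF root_leaf apex_edge] leaf_in_leaves(2,3)[OF that] by simp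
  then show ?thesis by (auto simp: leaf_indices_def)
qed

lemma m_pos: "0 < m"
  using leaf_indices_nonempty[OF apex] by (auto simp: leaf_indices_apex)

lemma leaf_indices_leaf: "i < m \<Longrightarrow> leaf_indices (leaf i) = {i}"
  using desc_leaf[OF leaf_in_leaves(1,3)] leaf_eq_iff by (auto simp: leaf_indices_def)

sublocale intervals: interval_tree "V - {r}" start stop m apex leaf
proof unfold_locales
  show "start v < stop v" if "v \<in> V - {r}" for v
    using leaf_indices_interval(2) that by simp
  show "v = w" if "v \<in> V - {r}" "w \<in> V - {r}" "start v = start w" "stop v = stop w" for v w
    using that by (intro desc_antisym) (simp_all add: desc_iff_interval)
  show "stop v \<le> start w \<or> stop w \<le> start v \<or> start v \<le> start w \<and> stop w \<le> stop v \<or>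
      start w \<le> start v \<and> stop v \<le> stop w"
    if vw: "v \<in> V - {r}" "w \<in> V - {r}" for v w
  proof (cases "v \<in> desc w \<or> w \<in> desc v")
    case True
    then show ?thesis using vw by (auto simp: desc_iff_interval)
  next
    case False
    then have "{start v..<stop v} \<inter> {start w..<stop w} = {}"
      using leaf_indices_disjoint[of v w] leaf_indices_interval(1) vw by auto
    then have "max (start v) (start w) \<notin> {start v..<stop v} \<inter> {start w..<stop w}" by blast
    then show ?thesis using leaf_indices_interval(2)[of v] leaf_indices_interval(2)[of w] vw by auto
  qed
  show "stop v \<le> m" if "v \<in> V - {r}" for v
  proof -
    have "Max (leaf_indices v) \<in> leaf_indices v"
      using finite_leaf_indices leaf_indices_nonempty that by (intro Max_in) auto
    then show ?thesis by (simp add: stop_def leaf_indices_def)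
  qed
  show "apex \<in> V - {r}" using apex by simp
  have "{start apex..<stop apex} = {0..<m}"
    using leaf_indices_interval(1)[OF apex] leaf_indices_apex by simp
  then show "start apex = 0" "stop apex = m"
    using m_pos leaf_indices_interval(2)[OF apex] by (simp_all add: atLeastLessThan_eq_iff)
  show "leaf i \<in> V - {r}" if "i < m" for i using leaf_in_leaves[OF that] by simp
  show "start (leaf i) = i" "stop (leaf i) = Suc i" if "i < m" for i
    using leaf_indices_leaf[OF that] by (simp_all add: start_def stop_def)
qed

lemma below_iff_desc:
  "intervals.below w v \<longleftrightarrow> w \<in> V \<and> w \<noteq> r \<and> v \<in> V \<and> v \<noteq> r \<and> w \<noteq> v \<and> w \<in> desc v"
  using desc_iff_interval[of v w] by (auto simp: intervals.below_def)

lemma child_if_edge: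
  assumes "{v, w} \<in> T" "v \<noteq> r" "w \<noteq> r" "w \<in> desc v"
  shows "intervals.child w v"
  unfolding intervals.child_def below_iff_desc
  using edgeD[OF assms(1)] assms no_desc_between[OF assms(1)] by blast

text \<open>
  The gaps are numbered from 0 to \<open>m\<close>; the root \<open>r\<close> is in the bags of all of them.
\<close>

definition first_gap :: "'a \<Rightarrow> nat" where
  "first_gap v = (if v = r then 0 else intervals.lo v)"

definition last_gap :: "'a \<Rightarrow> nat" where
  "last_gap v = (if v = r then m else intervals.hi v)"

definition layer :: "'a \<Rightarrow> nat" where
  "layer v = (if v = r then 0 else intervals.level v)"

text \<open>
  What the ends of an edge have to satisfy: there is a common bag, and the layers are equal or consecutive.
\<close>

definition compatible :: "'a \<Rightarrow> 'a \<Rightarrow> bool" where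
  "compatible u w \<longleftrightarrow> u \<in> V \<and> w \<in> V \<and> first_gap u \<le> last_gap w \<and> first_gap w \<le> last_gap u \<and>
     layer u \<le> Suc (layer w) \<and> layer w \<le> Suc (layer u)"

lemma compatible_sym: "compatible u w \<Longrightarrow> compatible w u"
  by (auto simp: compatible_def)

lemma gap_bounds: "v \<in> V \<Longrightarrow> first_gap v \<le> last_gap v \<and> last_gap v \<le> m"
  using intervals.lo_hi(2,3)[of v] intervals.bounded[of v]
  by (auto simp: first_gap_def last_gap_def)

lemma compatible_child: "intervals.child w v \<Longrightarrow> compatible w v"
  using intervals.child_lo_hi[of w v] intervals.child_level[of w v] intervals.childD(1,2)[of w v]
  by (auto simp: compatible_def first_gap_def last_gap_def layer_def)

lemma compatible_root: "w \<in> V \<Longrightarrow> layer w \<le> 1 \<Longrightarrow> compatible r w"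
  using gap_bounds[of w] r by (auto simp: compatible_def first_gap_def last_gap_def layer_def)

lemma compatible_root_apex: "compatible r apex"
  using apex intervals.level_root by (intro compatible_root) (auto simp: layer_def)

lemma compatible_tree_edge:
  assumes e: "{u, w} \<in> T"
  shows "compatible u w"
proof -
  consider "u = r" | "w = r" | "u \<noteq> r" "w \<noteq> r" by blast
  then show ?thesis
  proof cases
    case 1
    then have "w = apex"
      using leaf_neighbour_unique[OF simple root_leaf apex_edge, of w] e by simp
    then show ?thesis using compatible_root_apex 1 by simp
  next
    case 2
    then have "u = apex"
      using leaf_neighbour_unique[OF simple root_leaf apex_edge, of u] e by (simp add: insert_commute)
    then show ?thesis using compatible_sym[OF compatible_root_apex] 2 by simp
  next
    case 3
    then consider "u \<in> desc w" | "w \<in> desc u" using edge_desc[OF e] by blast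
    then show ?thesis
    proof cases
      case 1
      have "{w, u} \<in> T" using e by (simp add: insert_commute)
      then show ?thesis using 1 3 by (intro compatible_child child_if_edge)
    next
      case 2
      then show ?thesis using 3 e by (intro compatible_sym[OF compatible_child] child_if_edge)
    qed
  qed
qed

lemma compatible_end_leaves: "compatible r (leaf 0)" "compatible r (leaf (m - 1))"
  using m_pos leaf_in_leaves(2,3) intervals.end_leaf_levels
  by (auto intro!: compatible_root simp: layer_def)

lemma compatible_consecutive_leaves:
  assumes i: "Suc i < m"
  shows "compatible (leaf i) (leaf (Suc i))"
  using leaf_in_leaves(2,3)[of i] leaf_in_leaves(2,3)[OF i] intervals.leaf_lo_hi_level[of i]
    intervals.leaf_lo_hi_level[OF i] intervals.consecutive_leaf_levels[OF i] i
  by (simp add: compatible_def first_gap_def last_gap_def layer_def)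

lemma compatible_cycle_edge:
  assumes "i < length ls"
  shows "compatible (ls ! i) (ls ! (Suc i mod length ls))"
proof -
  consider "i = 0" | i' where "i = Suc i'" "Suc i' < m" | "i = m"
    using assms length_ls by (cases i) (auto simp: less_Suc_eq)
  then show ?thesis
  proof cases
    case 1
    then show ?thesis
      using compatible_end_leaves(1) m_pos by (simp add: length_ls first_leaf leaf_def)
  next
    case 2
    then show ?thesis
      using compatible_consecutive_leaves[OF 2(2)] by (simp add: length_ls leaf_def)
  next
    case 3
    then show ?thesis
      using compatible_sym[OF compatible_end_leaves(2)] m_pos
      by (simp add: length_ls first_leaf leaf_def)
  qed
qed

lemma card_bag_layer_le_2:
  "card {v \<in> V. layer v = j \<and> first_gap v \<le> g \<and> g \<le> last_gap v} \<le> 2" (is "card ?S \<le> 2")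
proof (cases "j = 0")
  case True
  have "?S \<subseteq> {r, apex}"
    using intervals.level_0_imp_root True by (auto simp: layer_def split: if_splits)
  then have "card ?S \<le> card {r, apex}" by (rule card_mono[rotated]) simp
  also have "\<dots> \<le> 2" by (simp add: card_insert_if)
  finally show ?thesis .
next
  case False
  then have "?S = {v \<in> V - {r}. intervals.level v = j \<and> intervals.lo v \<le> g \<and> g \<le> intervals.hi v}"
    by (auto simp: layer_def first_gap_def last_gap_def split: if_splits)
  then show ?thesis using intervals.card_bag_level_le_2 by simp
qed

lemma layered_pathwidth_le_2: "layered_pathwidth V (T \<union> cycle_edges ls) \<le> 2"
proof (rule layered_pathwidth_le_by_intervals
    [where x = first_gap and y = last_gap and L = layer and m = m, OF finite_V gap_bounds])
  show "card {v \<in> V. layer v = j \<and> first_gap v \<le> g \<and> g \<le> last_gap v} \<le> 2" for g j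
    by (rule card_bag_layer_le_2)
  fix e assume "e \<in> T \<union> cycle_edges ls"
  then have "\<exists>u w. e = {u, w} \<and> compatible u w"
  proof
    assume "e \<in> T"
    then have "card e = 2" using simple by (simp add: simple_graph_def)
    then obtain u w where "e = {u, w}" by (auto simp: card_2_iff)
    then show ?thesis using compatible_tree_edge \<open>e \<in> T\<close> by blast
  next
    assume "e \<in> cycle_edges ls"
    then show ?thesis using compatible_cycle_edge by (auto simp: cycle_edges_def)
  qed
  then show "\<exists>u w. e = {u, w} \<and> u \<in> V \<and> w \<in> V \<and> first_gap u \<le> last_gap w \<and>
      first_gap w \<le> last_gap u \<and> layer u \<le> Suc (layer w) \<and> layer w \<le> Suc (layer u)"
    unfolding compatible_def by blast
qed

end

theorem corollary18:
  fixes V :: "'a set" and E :: "'a set set"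
  assumes "halin_graph V E"
  shows "layered_pathwidth V E \<le> 2"
proof -
  obtain T pos crv ls where tree: "tree_graph V T" and card4: "4 \<le> card V"
    and deg: "\<forall>v\<in>V. vdegree T v \<noteq> 2"
    and emb: "plane_embedding V T pos crv" and lord: "leaf_order V T pos crv ls"
    and E: "E = T \<union> cycle_edges ls"
    using assms unfolding halin_graph_def by blast
  \<comment> \<open>An arbitrary root serves to show that there is a leaf; the tree is then rooted again at the first leaf.\<close>
  obtain r0 where r0: "r0 \<in> V" using card4 by fastforce
  have "V \<noteq> {r0}" using card4 by auto
  then obtain v where v: "v \<in> V" "v \<noteq> r0" using r0 by blast
  interpret R: rooted_tree V T r0
    by unfold_locales (use tree deg r0 in auto)
  have "set ls \<noteq> {}" using R.leaf_in_desc[OF v] lord by (auto simp: leaf_order_def)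
  then have len: "length ls = Suc (length ls - 1)" by simp
  then have "ls ! 0 \<in> set ls" by (intro nth_mem) linarith
  then have "ls ! 0 \<in> V" using lord by (auto simp: leaf_order_def leaves_def)
  then interpret P: plane_rooted_tree V T "ls ! 0" pos crv ls "length ls - 1"
    by unfold_locales (use tree deg emb lord len in auto)
  show ?thesis unfolding E by (rule P.layered_pathwidth_le_2)
qed

end
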